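(* Let $X$ be a non-empty set and let $(k,\ell)$ be a pair of kernels on $X$ that possesses a Shimorin certificate. Then $(k,\ell)$ is a complete Pick pair.
   Context: A kernel on a non-empty set $X$ is a function $k:X\times X\to\mathbb{C}$ such that $[k(z_i,z_j)]_{i,j=1}^n$ is positive semi-definite for all finite choices of points; $k_1\succeq k_2$ (or $k_2\preceq k_1$) means $k_1-k_2$ is a kernel; $\mathcal{H}_k$ is the reproducing kernel Hilbert space. Standing assumption: $k(x,x)\ne0\ne\ell(x,x)$ for all $x\in X$. For $z\in X$, $k^z(w,v)=k(w,v)-\frac{k(w,z)k(z,v)}{k(z,z)}$ and similarly for $\ell^z$. A Shimorin certificate for $(k,\ell)$ is a family of kernels $\{p[z]\}_{z\in X}$ on $X$ (possibly vanishing on the diagonal) such that $\ell^z\succeq p[z]\ell$ and $k^z\preceq p[z]k$ for every $z\in X$ (pointwise products). $\mathrm{Mult}(\mathcal{H}_k\otimes\mathbb{C}^N,\mathcal{H}_\ell\otimes\mathbb{C}^N)$ is the set of $\Phi:X\to\mathbb{M}_N$ (complex $N\times N$ matrices) with $\Phi f\in\mathcal{H}_\ell\otimes\mathbb{C}^N$ for all $f\in\mathcal{H}_k\otimes\mathbb{C}^N$, normed by the operator norm of $f\mapsto\Phi f$. $(k,\ell)$ is a complete Pick pair on $X$ if for all $n,N\ge1$, all $z_1,\dots,z_n\in X$ and all $W_1,\dots,W_n\in\mathbb{M}_N$ with $[\ell(z_i,z_j)I_{N\times N}-k(z_i,z_j)W_iW_j^*]_{i,j=1}^n$ positive semi-definite,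 there is $\Phi\in\mathrm{Mult}(\mathcal{H}_k\otimes\mathbb{C}^N,\mathcal{H}_\ell\otimes\mathbb{C}^N)$ of norm at most one with $\Phi(z_i)=W_i$ for all $i$. *)

theory Defs
  imports "HOL-Library.Extended_Nonnegative_Real" "Jordan_Normal_Form.Schur_Decomposition"
begin

text \<open>
  The non-empty set \<open>X\<close> is the type \<open>'x\<close>. The order on \<^typ>\<open>complex\<close> is the one of
  \<^theory>\<open>HOL-Library.Complex_Order\<close>: \<open>0 \<le> z\<close> says that \<open>z\<close> is real and non-negative.
\<close>

definition is_kernel :: "('x \<Rightarrow> 'x \<Rightarrow> complex) \<Rightarrow> bool" where
  "is_kernel k \<longleftrightarrow>
     (\<forall>(n::nat) (z::nat \<Rightarrow> 'x) (c::nat \<Rightarrow> complex).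
        0 \<le> (\<Sum>i<n. \<Sum>j<n. cnj (c i) * k (z i) (z j) * c j))"

definition kernel_le :: "('x \<Rightarrow> 'x \<Rightarrow> complex) \<Rightarrow> ('x \<Rightarrow> 'x \<Rightarrow> complex) \<Rightarrow> bool" where
  "kernel_le k1 k2 \<longleftrightarrow> is_kernel (\<lambda>w v. k2 w v - k1 w v)"

definition reduced_kernel :: "('x \<Rightarrow> 'x \<Rightarrow> complex) \<Rightarrow> 'x \<Rightarrow> 'x \<Rightarrow> 'x \<Rightarrow> complex" where
  "reduced_kernel k z w v = k w v - k w z * k z v / k z z"

definition shimorin_certificate ::
  "('x \<Rightarrow> 'x \<Rightarrow> complex) \<Rightarrow> ('x \<Rightarrow> 'x \<Rightarrow> complex) \<Rightarrow> ('x \<Rightarrow> 'x \<Rightarrow> 'x \<Rightarrow> complex) \<Rightarrow> bool" where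
  "shimorin_certificate k l p \<longleftrightarrow>
     (\<forall>z. is_kernel (p z) \<and>
          kernel_le (\<lambda>w v. p z w v * l w v) (reduced_kernel l z) \<and>
          kernel_le (reduced_kernel k z) (\<lambda>w v. p z w v * k w v))"

definition ip_norm :: "(('x \<Rightarrow> complex) \<Rightarrow> ('x \<Rightarrow> complex) \<Rightarrow> complex) \<Rightarrow> ('x \<Rightarrow> complex) \<Rightarrow> real" where
  "ip_norm ip f = sqrt (Re (ip f f))"

text \<open>
  \<open>rkhs k H ip\<close>: the set \<open>H\<close> of functions with the inner product \<open>ip\<close> (linear in the first
  argument; its values outside \<open>H\<close> are irrelevant) is the reproducing kernel Hilbert space of \<open>k\<close>.
  By the Moore--Aronszajn theorem each kernel \<open>k\<close> has such an \<open>H\<close>, and \<open>H\<close> as well as the values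
  of \<open>ip\<close> on \<open>H\<close> are determined by \<open>k\<close>.
\<close>

definition rkhs ::
  "('x \<Rightarrow> 'x \<Rightarrow> complex) \<Rightarrow> ('x \<Rightarrow> complex) set \<Rightarrow>
   (('x \<Rightarrow> complex) \<Rightarrow> ('x \<Rightarrow> complex) \<Rightarrow> complex) \<Rightarrow> bool" where
  "rkhs k H ip \<longleftrightarrow>
     (\<lambda>x. 0) \<in> H \<and>
     (\<forall>f\<in>H. \<forall>g\<in>H. (\<lambda>x. f x + g x) \<in> H) \<and>
     (\<forall>a. \<forall>f\<in>H. (\<lambda>x. a * f x) \<in> H) \<and>
     (\<forall>f\<in>H. \<forall>g\<in>H. \<forall>h\<in>H. ip (\<lambda>x. f x + g x) h = ip f h + ip g h) \<and>
     (\<forall>a. \<forall>f\<in>H. \<forall>g\<in>H. ip (\<lambda>x. a * f x) g = a * ip f g) \<and>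
     (\<forall>f\<in>H. \<forall>g\<in>H. ip g f = cnj (ip f g)) \<and>
     (\<forall>f\<in>H. 0 \<le> ip f f) \<and>
     (\<forall>f\<in>H. ip f f = 0 \<longrightarrow> f = (\<lambda>x. 0)) \<and>
     (\<forall>F::nat \<Rightarrow> 'x \<Rightarrow> complex.
        (\<forall>n. F n \<in> H) \<longrightarrow>
        (\<forall>e>0. \<exists>M. \<forall>m\<ge>M. \<forall>n\<ge>M. ip_norm ip (\<lambda>x. F m x - F n x) < e) \<longrightarrow>
        (\<exists>f\<in>H. (\<lambda>n. ip_norm ip (\<lambda>x. F n x - f x)) \<longlonglongrightarrow> 0)) \<and>
     (\<forall>w. (\<lambda>x. k x w) \<in> H) \<and>
     (\<forall>f\<in>H. \<forall>w. f w = ip f (\<lambda>x. k x w))"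

text \<open>
  \<open>H \<otimes> \<complex>\<^sup>N\<close>, as the space of \<open>\<complex>\<^sup>N\<close>-valued functions with all components in \<open>H\<close>, and its norm.
\<close>

definition tensor_space :: "nat \<Rightarrow> ('x \<Rightarrow> complex) set \<Rightarrow> ('x \<Rightarrow> complex vec) set" where
  "tensor_space N H =
     {f. (\<forall>x. f x \<in> carrier_vec N) \<and> (\<forall>i<N. (\<lambda>x. f x $ i) \<in> H)}"

definition tensor_norm ::
  "nat \<Rightarrow> (('x \<Rightarrow> complex) \<Rightarrow> ('x \<Rightarrow> complex) \<Rightarrow> complex) \<Rightarrow> ('x \<Rightarrow> complex vec) \<Rightarrow> real" where
  "tensor_norm N ip f = sqrt (\<Sum>i<N. (ip_norm ip (\<lambda>x. f x $ i))\<^sup>2)"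

definition Mult ::
  "nat \<Rightarrow> ('x \<Rightarrow> complex) set \<Rightarrow> ('x \<Rightarrow> complex) set \<Rightarrow> ('x \<Rightarrow> complex mat) set" where
  "Mult N H H' =
     {\<Phi>. (\<forall>x. \<Phi> x \<in> carrier_mat N N) \<and>
         (\<forall>f\<in>tensor_space N H. (\<lambda>x. \<Phi> x *\<^sub>v f x) \<in> tensor_space N H')}"

text \<open>
  The operator norm takes values in \<^typ>\<open>ennreal\<close>, so that the supremum is the intended one
  without a boundedness proof.
\<close>

definition mult_norm ::
  "nat \<Rightarrow> ('x \<Rightarrow> complex) set \<Rightarrow> (('x \<Rightarrow> complex) \<Rightarrow> ('x \<Rightarrow> complex) \<Rightarrow> complex) \<Rightarrow>
   (('x \<Rightarrow> complex) \<Rightarrow> ('x \<Rightarrow> complex) \<Rightarrow> complex) \<Rightarrow> ('x \<Rightarrow> complex mat) \<Rightarrow> ennreal" where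
  "mult_norm N H ip ip' \<Phi> =
     (SUP f \<in> {f \<in> tensor_space N H. tensor_norm N ip f \<le> 1}.
        ennreal (tensor_norm N ip' (\<lambda>x. \<Phi> x *\<^sub>v f x)))"

text \<open>
  Positive semi-definiteness of the \<open>n \<times> n\<close> block matrix with \<open>N \<times> N\<close> blocks \<open>B i j\<close>, tested
  against the block vector \<open>(u 0, \<dots>, u (n - 1))\<close>; \<open>\<bullet>c\<close> is conjugate-linear in its second argument.
\<close>

definition block_psd :: "nat \<Rightarrow> nat \<Rightarrow> (nat \<Rightarrow> nat \<Rightarrow> complex mat) \<Rightarrow> bool" where
  "block_psd n N B \<longleftrightarrow>
     (\<forall>u::nat \<Rightarrow> complex vec. (\<forall>i<n. u i \<in> carrier_vec N) \<longrightarrow>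
        0 \<le> (\<Sum>i<n. \<Sum>j<n. (B i j *\<^sub>v u j) \<bullet>c u i))"

text \<open>
  The spaces \<open>H\<close>, \<open>H'\<close> are the (unique) reproducing kernel Hilbert spaces of \<open>k\<close>, \<open>l\<close>.
\<close>

definition complete_pick_pair ::
  "('x \<Rightarrow> 'x \<Rightarrow> complex) \<Rightarrow> ('x \<Rightarrow> 'x \<Rightarrow> complex) \<Rightarrow> bool" where
  "complete_pick_pair k l \<longleftrightarrow>
     (\<forall>H ip H' ip'. rkhs k H ip \<longrightarrow> rkhs l H' ip' \<longrightarrow>
       (\<forall>n\<ge>1. \<forall>N\<ge>1. \<forall>(z::nat \<Rightarrow> 'x) (W::nat \<Rightarrow> complex mat).
          (\<forall>i<n. W i \<in> carrier_mat N N) \<longrightarrow>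
          block_psd n N (\<lambda>i j. l (z i) (z j) \<cdot>\<^sub>m 1\<^sub>m N - k (z i) (z j) \<cdot>\<^sub>m (W i * mat_adjoint (W j))) \<longrightarrow>
          (\<exists>\<Phi>\<in>Mult N H H'. mult_norm N H ip ip' \<Phi> \<le> 1 \<and> (\<forall>i<n. \<Phi> (z i) = W i))))"

end

theory Submission
  imports Defs "HOL-Analysis.Convex"
begin

text \<open>
Write \<open>W\<^sub>x\<close> for the value of an interpolant at \<open>x\<close>. A function on a set of points is a contractive
multiplier there when the block kernel \<open>l(x,y) I - k(x,y) W\<^sub>x W\<^sub>y\<^sup>*\<close> is positive semi-definite, and this
condition involves only finitely many points at a time. So it suffices to extend an interpolant, given
on an arbitrary set \<open>D\<close> with a positive block kernel, to one more point \<open>z\<close>: Zorn's lemma then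
produces an interpolant on the whole space, and the positivity of its block kernel makes it a
multiplier of norm at most one.

The one-point extension (\<open>pick_one_point_extension\<close>) is a variant of Parrott's completion argument.
Split off the value at \<open>z\<close> with \<open>k(x,y) = k\<^sup>z(x,y) + k(x,z) k(z,y) / k(z,z)\<close>, where the second term is
\<open>u\<^sub>x\<close> times the conjugate of \<open>u\<^sub>y\<close>. The block kernel becomes \<open>C - V V\<^sup>*\<close> with
\<open>C(x,y) = l(x,y) I - k\<^sup>z(x,y) W\<^sub>x W\<^sub>y\<^sup>*\<close> and \<open>V\<^sub>x = u\<^sub>x W\<^sub>x\<close>. Since \<open>k\<^sup>z\<close> vanishes when an argument is \<open>z\<close>, the
kernel \<open>C\<close> does not contain the unknown \<open>W\<^sub>z\<close>; only the row \<open>V\<^sub>z\<close> of \<open>V\<close> does.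

This is where the certificate enters. Modulo the positive kernel \<open>l(x,z) l(z,y) / l(z,z) I\<close>, the kernel
\<open>C\<close> is \<open>l\<^sup>z I - k\<^sup>z W W\<^sup>*\<close>, which is the sum of \<open>(l\<^sup>z - p l) I\<close>, of \<open>(p k - k\<^sup>z) W W\<^sup>*\<close> and of
\<open>p (l I - k W W\<^sup>*)\<close>. All three are positive by the Schur product theorem. Hence \<open>C\<close> is a positive
kernel on \<open>D\<close> together with \<open>z\<close>, and \<open>C - V V\<^sup>*\<close> is positive on \<open>D\<close>. The latter says that \<open>V\<close> defines
a contraction from the finitely supported functions on \<open>D\<close>, with the semi-norm of \<open>C\<close>, to a finite-dimensional
Hilbert space. A contraction extends from a subspace of a pre-Hilbert space to the whole space:
project onto the closure of the subspace (\<open>contraction_extends_to_point\<close>). The rows of the extended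
contraction at \<open>z\<close> give \<open>V\<^sub>z\<close>, hence \<open>W\<^sub>z\<close>. The projection exists in the completion for an infinite \<open>D\<close>
as well, which is why one step of this kind is all that Zorn's lemma asks for.

Both the projection in this step and the final passage from a positive block kernel to a multiplier
are instances of one approximate form of the Riesz representation theorem (\<open>approximate_riesz\<close>),
which replaces the completion of the space of finitely supported coefficients by sequences in it.
\<close>

section \<open>Positive semi-definite kernels\<close>

lemma complex_nonneg_iff: "0 \<le> (z::complex) \<longleftrightarrow> 0 \<le> Re z \<and> Im z = 0"
  by (auto simp: less_eq_complex_def)

text \<open>
The source of all Cauchy--Schwarz type estimates below: the minimum of the quadratic polynomial over
\<open>t\<close> is non-negative. The case \<open>\<gamma> = 0\<close>, which semi-norms make unavoidable, forces \<open>\<beta> = 0\<close>.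
\<close>

lemma quadratic_nonneg_imp_discriminant:
  fixes \<beta> :: complex
  assumes "0 \<le> \<gamma>" and nn: "\<And>t::complex. 0 \<le> \<alpha> + 2 * Re (t * \<beta>) + (cmod t)\<^sup>2 * \<gamma>"
  shows "(cmod \<beta>)\<^sup>2 \<le> \<alpha> * \<gamma>"
proof (cases "\<gamma> = 0")
  case True
  have "\<beta> = 0"
  proof (rule ccontr)
    assume "\<beta> \<noteq> 0"
    then have pos: "(cmod \<beta>)\<^sup>2 > 0" by simp
    \<comment> \<open>With this \<open>s\<close> the linear term equals \<open>- (\<alpha> + 1)\<close>, so that the value at the chosen \<open>t\<close> is -1.\<close>
    define s where "s = (\<alpha> + 1) / (2 * (cmod \<beta>)\<^sup>2)"
    have "Re (- of_real s * cnj \<beta> * \<beta>) = - (s * (cmod \<beta>)\<^sup>2)"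
      by (simp add: cmod_power2 power2_eq_square[of "Re _"] power2_eq_square[of "Im _"] algebra_simps)
    moreover have "2 * (s * (cmod \<beta>)\<^sup>2) = \<alpha> + 1"
      using pos by (simp add: s_def)
    ultimately show False
      using nn[of "- of_real s * cnj \<beta>"] True by simp
  qed
  then show ?thesis using True by simp
next
  case False
  then have pos: "\<gamma> > 0" using assms(1) by simp
  have 1: "Re (- (cnj \<beta> / of_real \<gamma>) * \<beta>) = - ((cmod \<beta>)\<^sup>2 / \<gamma>)"
    unfolding cmod_power2 by (simp add: power2_eq_square add_divide_distrib)
  have 2: "(cmod (- (cnj \<beta> / of_real \<gamma>)))\<^sup>2 * \<gamma> = (cmod \<beta>)\<^sup>2 / \<gamma>"
    using pos by (simp add: norm_divide power_divide power2_eq_square)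
  have "0 \<le> \<alpha> - (cmod \<beta>)\<^sup>2 / \<gamma>"
    using nn[of "- (cnj \<beta> / of_real \<gamma>)"] unfolding 1 2 by simp
  then show ?thesis using pos by (simp add: field_simps)
qed

text \<open>
Finite subsets and coefficients on them replace the finite sequences of \<^const>\<open>is_kernel\<close>, so that
no repetitions of points occur and restriction to a subset is immediate.
\<close>

definition psd_on :: "'i set \<Rightarrow> ('i \<Rightarrow> 'i \<Rightarrow> complex) \<Rightarrow> bool" where
  "psd_on S K \<longleftrightarrow>
     (\<forall>F c. finite F \<longrightarrow> F \<subseteq> S \<longrightarrow> 0 \<le> (\<Sum>i\<in>F. \<Sum>j\<in>F. cnj (c i) * K i j * c j))"

lemma psd_onD: "psd_on S K \<Longrightarrow> finite F \<Longrightarrow> F \<subseteq> S \<Longrightarrow> 0 \<le> (\<Sum>i\<in>F. \<Sum>j\<in>F. cnj (c i) * K i j * c j)"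
  by (auto simp: psd_on_def)

lemma psd_on_subset: "psd_on T K \<Longrightarrow> S \<subseteq> T \<Longrightarrow> psd_on S K"
  by (auto simp: psd_on_def)

lemma psd_on_cong:
  assumes "psd_on S K" "\<And>i j. i \<in> S \<Longrightarrow> j \<in> S \<Longrightarrow> K' i j = K i j"
  shows "psd_on S K'"
  unfolding psd_on_def
proof (intro allI impI)
  fix F :: "'a set" and c assume F: "finite F" "F \<subseteq> S"
  have "(\<Sum>i\<in>F. \<Sum>j\<in>F. cnj (c i) * K' i j * c j) = (\<Sum>i\<in>F. \<Sum>j\<in>F. cnj (c i) * K i j * c j)"
    by (intro sum.cong refl) (use assms(2) F in auto)
  then show "0 \<le> (\<Sum>i\<in>F. \<Sum>j\<in>F. cnj (c i) * K' i j * c j)"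
    using psd_onD[OF assms(1) F] by simp
qed

lemma psd_on_add:
  assumes "psd_on S K" "psd_on S L"
  shows "psd_on S (\<lambda>i j. K i j + L i j)"
  using psd_onD[OF assms(1)] psd_onD[OF assms(2)]
  by (auto simp: psd_on_def algebra_simps sum.distrib intro: add_nonneg_nonneg)

lemma psd_on_gram:
  fixes S :: "'i set"
  assumes "finite R"
  shows "psd_on S (\<lambda>i j. \<Sum>r\<in>R. v i r * cnj (v j r))"
  unfolding psd_on_def
proof (intro allI impI)
  fix F :: "'i set" and c
  have "(\<Sum>i\<in>F. \<Sum>j\<in>F. cnj (c i) * (\<Sum>r\<in>R. v i r * cnj (v j r)) * c j)
      = (\<Sum>r\<in>R. (\<Sum>i\<in>F. cnj (c i) * v i r) * cnj (\<Sum>j\<in>F. cnj (c j) * v j r))"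
    unfolding cnj_sum sum_product sum_distrib_left sum_distrib_right
    by (subst (2) sum.swap, subst sum.swap) (subst (2) sum.swap, simp add: mult_ac)
  moreover have "0 \<le> z * cnj z" for z :: complex
    by (simp add: complex_nonneg_iff)
  ultimately show "0 \<le> (\<Sum>i\<in>F. \<Sum>j\<in>F. cnj (c i) * (\<Sum>r\<in>R. v i r * cnj (v j r)) * c j)"
    by (simp only: sum_nonneg)
qed

lemma psd_on_diag:
  assumes "psd_on S K" "i \<in> S"
  shows "0 \<le> K i i"
  using psd_onD[OF assms(1), of "{i}" "\<lambda>_. 1"] assms(2) by simp

lemma psd_on_hermitian:
  assumes "psd_on S K" "i \<in> S" "j \<in> S"
  shows "K j i = cnj (K i j)"
proof (cases "i = j")
  case True
  then show ?thesis using psd_on_diag[OF assms(1,2)] by (simp add: complex_eq_iff complex_nonneg_iff)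
next
  case False
  have d: "Im (K i i) = 0" "Im (K j j) = 0"
    using psd_on_diag[OF assms(1)] assms by (auto simp: complex_nonneg_iff)
  have *: "Im (K i i + K i j * t + (cnj t * K j i + cnj t * K j j * t)) = 0" for t
    using psd_onD[OF assms(1), of "{i, j}" "\<lambda>x. if x = i then 1 else t"] assms False
    by (simp add: complex_nonneg_iff)
  show ?thesis
    using *[of 1] *[of \<i>] d by (simp add: complex_eq_iff)
qed

lemma psd_on_quadratic:
  assumes K: "psd_on (insert x F) K" and F: "finite F" "x \<notin> F"
  shows "0 \<le> Re (\<Sum>i\<in>F. \<Sum>j\<in>F. cnj (c i) * K i j * c j)
            + 2 * Re (t * (\<Sum>i\<in>F. cnj (c i) * K i x)) + (cmod t)\<^sup>2 * Re (K x x)"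
proof -
  define c' where "c' = c(x := t)"
  have c': "c' x = t" "\<And>i. i \<in> F \<Longrightarrow> c' i = c i" using F by (auto simp: c'_def)
  let ?b = "\<Sum>i\<in>F. cnj (c i) * K i x"
  have h: "K x j = cnj (K j x)" if "j \<in> F" for j
    using psd_on_hermitian[OF K, of j x] that by simp
  have "0 \<le> (\<Sum>i\<in>insert x F. \<Sum>j\<in>insert x F. cnj (c' i) * K i j * c' j)"
    by (rule psd_onD[OF K]) (use F in auto)
  also have "\<dots> = cnj t * K x x * t + cnj (t * ?b) + (t * ?b + (\<Sum>i\<in>F. \<Sum>j\<in>F. cnj (c i) * K i j * c j))"
    using F c' by (simp add: sum.distrib h sum_distrib_left mult_ac cong: sum.cong_simp)
  finally have "0 \<le> Re (cnj t * K x x * t + cnj (t * ?b) + (t * ?b + (\<Sum>i\<in>F. \<Sum>j\<in>F. cnj (c i) * K i j * c j)))"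
    by (simp only: complex_nonneg_iff)
  moreover have "Im (K x x) = 0" using psd_on_diag[OF K, of x] by (simp add: complex_nonneg_iff)
  then have "Re (cnj t * K x x * t) = (cmod t)\<^sup>2 * Re (K x x)"
    unfolding cmod_power2 by (simp add: power2_eq_square algebra_simps)
  ultimately show ?thesis by (simp only: plus_complex.sel cnj.sel)
qed

lemma psd_on_cauchy_schwarz:
  assumes "psd_on S K" "i \<in> S" "j \<in> S"
  shows "(cmod (K i j))\<^sup>2 \<le> Re (K i i) * Re (K j j)"
proof (cases "i = j")
  case True
  have "Im (K i i) = 0" using psd_on_diag[OF assms(1,2)] by (simp add: complex_nonneg_iff)
  then have "(cmod (K i i))\<^sup>2 = Re (K i i) * Re (K i i)"
    by (simp only: cmod_power2) (simp add: power2_eq_square)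
  then show ?thesis using True by simp
next
  case False
  have K: "psd_on (insert j {i}) K" by (rule psd_on_subset[OF assms(1)]) (use assms in auto)
  show ?thesis
    by (rule quadratic_nonneg_imp_discriminant)
       (use psd_on_quadratic[OF K, of "\<lambda>_. 1"] False psd_on_diag[OF assms(1,3)] in
         \<open>auto simp: complex_nonneg_iff\<close>)
qed

text \<open>
Minimising the quadratic form over the coefficient at \<open>x\<close> leaves the form of the reduced kernel.
\<close>

lemma psd_on_schur_complement:
  assumes K: "psd_on (insert x F) K" and F: "finite F" "x \<notin> F" and nz: "K x x \<noteq> 0"
  shows "psd_on F (\<lambda>i j. K i j - K i x * K x j / K x x)"
  unfolding psd_on_def
proof (intro allI impI)
  fix G c assume G: "finite G" "G \<subseteq> F"
  have xx: "0 \<le> K x x" using psd_on_diag[OF K, of x] by simp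
  then have pos: "Re (K x x) > 0" and Im: "Im (K x x) = 0"
    using nz by (auto simp: complex_nonneg_iff complex_eq_iff less_le)
  then have Kxx: "K x x = of_real (Re (K x x))" by (simp add: complex_eq_iff)
  let ?a = "\<Sum>i\<in>G. \<Sum>j\<in>G. cnj (c i) * K i j * c j" and ?b = "\<Sum>i\<in>G. cnj (c i) * K i x"
  have KG: "psd_on (insert x G) K" by (rule psd_on_subset[OF K]) (use G in auto)
  have "(cmod ?b)\<^sup>2 \<le> Re ?a * Re (K x x)"
    by (rule quadratic_nonneg_imp_discriminant)
       (use pos psd_on_quadratic[OF KG G(1)] G F(2) in auto)
  then have 1: "(cmod ?b)\<^sup>2 / Re (K x x) \<le> Re ?a" using pos by (simp add: field_simps)
  have b: "cnj ?b = (\<Sum>j\<in>G. K x j * c j)"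
    unfolding cnj_sum
    by (intro sum.cong refl) (use psd_on_hermitian[OF KG, of _ x] G(2) in \<open>auto simp: mult_ac\<close>)
  have "(\<Sum>i\<in>G. \<Sum>j\<in>G. cnj (c i) * (K i j - K i x * K x j / K x x) * c j)
      = ?a - ?b * cnj ?b / K x x"
    unfolding b sum_product
    by (simp add: algebra_simps sum_subtractf sum_divide_distrib)
  also have "\<dots> = ?a - of_real ((cmod ?b)\<^sup>2 / Re (K x x))"
    by (subst Kxx) (simp only: of_real_divide complex_norm_square)
  finally have eq: "(\<Sum>i\<in>G. \<Sum>j\<in>G. cnj (c i) * (K i j - K i x * K x j / K x x) * c j) = \<dots>" .
  have "0 \<le> ?a" by (rule psd_onD[OF KG]) (use G in auto)
  then show "0 \<le> (\<Sum>i\<in>G. \<Sum>j\<in>G. cnj (c i) * (K i j - K i x * K x j / K x x) * c j)"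
    unfolding eq using 1 by (simp add: complex_nonneg_iff)
qed

text \<open>
The kernel \<open>K(i,x) K(x,j) / K(x,x)\<close>, which is the difference between \<open>K\<close> and its reduction at \<open>x\<close>, has
rank one.
\<close>

lemma psd_on_section_factor:
  assumes K: "psd_on S K" and x: "x \<in> S" and nz: "K x x \<noteq> 0"
  obtains u where "\<And>i j. i \<in> S \<Longrightarrow> j \<in> S \<Longrightarrow> K i x * K x j / K x x = u i * cnj (u j)" and "u x \<noteq> 0"
proof -
  define s where "s = sqrt (Re (K x x))"
  have ss: "K x x = of_real s * of_real s"
    using psd_on_diag[OF K x] by (simp add: s_def complex_eq_iff complex_nonneg_iff)
  show ?thesis
  proof (rule that)
    fix i j assume "i \<in> S" "j \<in> S"
    then have "K x j = cnj (K j x)" using psd_on_hermitian[OF K _ x] by blast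
    then show "K i x * K x j / K x x = K i x / of_real s * cnj (K j x / of_real s)"
      by (simp only: ss) simp
  qed (use ss nz in auto)
qed

text \<open>
Cholesky factorisation: split off the rank one kernel at \<open>x\<close> and apply the induction hypothesis to
the Schur complement. If \<open>K(x,x) = 0\<close>, then the row of \<open>x\<close> vanishes and \<open>x\<close> gets the zero vector.
\<close>

lemma finite_psd_on_imp_gram:
  assumes "finite F" "psd_on F K"
  shows "\<exists>(m::nat) v. \<forall>i\<in>F. \<forall>j\<in>F. K i j = (\<Sum>r<m. v i r * cnj (v j r))"
  using assms
proof (induction F arbitrary: K rule: finite_induct)
  case empty
  then show ?case by simp
next
  case (insert x F)
  note K = insert.prems
  show ?case
  proof (cases "K x x = 0")
    case True
    have z: "K i x = 0" if "i \<in> insert x F" for i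
      using psd_on_cauchy_schwarz[OF K that, of x] True by simp
    have z': "K x i = 0" if "i \<in> insert x F" for i
      using psd_on_hermitian[OF K that, of x] z[OF that] by simp
    have "psd_on F K" by (rule psd_on_subset[OF K]) auto
    from insert.IH[OF this] obtain m :: nat and v where
      v: "\<forall>i\<in>F. \<forall>j\<in>F. K i j = (\<Sum>r<m. v i r * cnj (v j r))" by blast
    have "\<forall>i\<in>insert x F. \<forall>j\<in>insert x F.
        K i j = (\<Sum>r<m. (v(x := \<lambda>_. 0)) i r * cnj ((v(x := \<lambda>_. 0)) j r))"
      using v z z' insert.hyps(2) by auto
    then show ?thesis by blast
  next
    case False
    obtain u where
      u: "\<And>i j. i \<in> insert x F \<Longrightarrow> j \<in> insert x F \<Longrightarrow> K i x * K x j / K x x = u i * cnj (u j)"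
      and "u x \<noteq> 0"
      by (rule psd_on_section_factor[OF K insertI1 False]) (rule that)
    from insert.IH[OF psd_on_schur_complement[OF K insert.hyps False]]
    obtain m :: nat and v where
      v: "\<forall>i\<in>F. \<forall>j\<in>F. K i j - K i x * K x j / K x x = (\<Sum>r<m. v i r * cnj (v j r))" by blast
    define w where "w i r = (if r = m then u i else if i = x then 0 else v i r)" for i r
    have "K i j = (\<Sum>r<Suc m. w i r * cnj (w j r))" if i: "i \<in> insert x F" and j: "j \<in> insert x F" for i j
    proof -
      have "w i m * cnj (w j m) = K i x * K x j / K x x"
        using u[OF i j] by (simp add: w_def)
      moreover have "(\<Sum>r<m. w i r * cnj (w j r)) = K i j - K i x * K x j / K x x"
      proof (cases "i = x \<or> j = x")
        case True
        then show ?thesis using \<open>K x x \<noteq> 0\<close> by (auto simp: w_def intro!: sum.neutral)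
      next
        case False
        then have "i \<in> F" "j \<in> F" using i j by auto
        then have "K i j - K i x * K x j / K x x = (\<Sum>r<m. v i r * cnj (v j r))" using v by blast
        then show ?thesis using False by (simp add: w_def)
      qed
      ultimately show ?thesis by simp
    qed
    then show ?thesis by blast
  qed
qed

text \<open>
The map \<open>f\<close> may identify points; with Gram vectors there are no coefficients to collect.
\<close>

lemma psd_on_pullback:
  assumes K: "psd_on T K" and f: "f ` S \<subseteq> T"
  shows "psd_on S (\<lambda>i j. K (f i) (f j))"
  unfolding psd_on_def
proof (intro allI impI)
  fix F c assume F: "finite F" "F \<subseteq> S"
  have "psd_on (f ` F) K" by (rule psd_on_subset[OF K]) (use f F in auto)
  from finite_psd_on_imp_gram[OF _ this] F obtain m :: nat and v where
    v: "\<forall>i\<in>f ` F. \<forall>j\<in>f ` F. K i j = (\<Sum>r<m. v i r * cnj (v j r))" by auto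
  have "psd_on F (\<lambda>i j. K (f i) (f j))"
    by (rule psd_on_cong[OF psd_on_gram[of "{..<m}" F "\<lambda>i. v (f i)"]]) (use v in auto)
  then show "0 \<le> (\<Sum>i\<in>F. \<Sum>j\<in>F. cnj (c i) * K (f i) (f j) * c j)"
    using F by (auto simp: psd_on_def)
qed

text \<open>
Gram vectors of a pointwise product are the tensor products of the Gram vectors of the factors.
\<close>

lemma psd_on_schur_product:
  assumes K: "psd_on S K" and L: "psd_on S L"
  shows "psd_on S (\<lambda>i j. K i j * L i j)"
  unfolding psd_on_def
proof (intro allI impI)
  fix F c assume F: "finite F" "F \<subseteq> S"
  obtain m :: nat and v where
    v: "\<forall>i\<in>F. \<forall>j\<in>F. K i j = (\<Sum>r<m. v i r * cnj (v j r))"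
    using finite_psd_on_imp_gram[OF F(1) psd_on_subset[OF K F(2)]] by auto
  obtain n :: nat and w where
    w: "\<forall>i\<in>F. \<forall>j\<in>F. L i j = (\<Sum>r<n. w i r * cnj (w j r))"
    using finite_psd_on_imp_gram[OF F(1) psd_on_subset[OF L F(2)]] by auto
  have "psd_on F (\<lambda>i j. K i j * L i j)"
    by (rule psd_on_cong[OF psd_on_gram[of "{..<m} \<times> {..<n}" F "\<lambda>i (r, s). v i r * w i s"]])
       (use v w in \<open>auto simp: sum_product sum.cartesian_product case_prod_unfold mult_ac\<close>)
  then show "0 \<le> (\<Sum>i\<in>F. \<Sum>j\<in>F. cnj (c i) * (K i j * L i j) * c j)"
    using F by (auto simp: psd_on_def)
qed

lemma psd_on_zero_extension:
  assumes K: "psd_on S K" and z: "\<And>i j. i \<in> T \<Longrightarrow> j \<in> T \<Longrightarrow> i \<notin> S \<or> j \<notin> S \<Longrightarrow> K i j = 0"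
  shows "psd_on T K"
  unfolding psd_on_def
proof (intro allI impI)
  fix F c assume F: "finite F" "F \<subseteq> T"
  have "(\<Sum>i\<in>F. \<Sum>j\<in>F. cnj (c i) * K i j * c j) = (\<Sum>i\<in>F \<inter> S. \<Sum>j\<in>F. cnj (c i) * K i j * c j)"
    by (rule sum.mono_neutral_right) (use F z in \<open>fastforce intro!: sum.neutral\<close>)+
  also have "\<dots> = (\<Sum>i\<in>F \<inter> S. \<Sum>j\<in>F \<inter> S. cnj (c i) * K i j * c j)"
    by (intro sum.cong refl sum.mono_neutral_right) (use F z in auto)
  finally show "0 \<le> (\<Sum>i\<in>F. \<Sum>j\<in>F. cnj (c i) * K i j * c j)"
    using psd_onD[OF K, of "F \<inter> S" c] F by simp
qed

section \<open>Finitely supported coefficients and the approximate Riesz theorem\<close>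

definition fin_supp :: "'i set \<Rightarrow> ('i \<Rightarrow> complex) set" where
  "fin_supp S = {c. finite {i. c i \<noteq> 0} \<and> {i. c i \<noteq> 0} \<subseteq> S}"

text \<open>
The vectors are coefficient functions \<open>c\<close> with finite support. Such a \<open>c\<close> stands for the combination
\<open>\<Sum>j. c j * K i j\<close> of sections of a kernel \<open>K\<close> (\<open>kernel_comb\<close>), and the pairing of a function with \<open>c\<close> is
what the inner product with this combination would be in the reproducing kernel Hilbert space of \<open>K\<close>;
\<open>hform\<close> is the resulting positive semi-definite Hermitian form.
\<close>

definition pairing :: "('i \<Rightarrow> complex) \<Rightarrow> ('i \<Rightarrow> complex) \<Rightarrow> complex" where
  "pairing c g = (\<Sum>i | c i \<noteq> 0. cnj (c i) * g i)"

definition kernel_comb :: "('i \<Rightarrow> 'i \<Rightarrow> complex) \<Rightarrow> ('i \<Rightarrow> complex) \<Rightarrow> 'i \<Rightarrow> complex" where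
  "kernel_comb K c i = (\<Sum>j | c j \<noteq> 0. K i j * c j)"

abbreviation hform :: "('i \<Rightarrow> 'i \<Rightarrow> complex) \<Rightarrow> ('i \<Rightarrow> complex) \<Rightarrow> ('i \<Rightarrow> complex) \<Rightarrow> complex" where
  "hform K c d \<equiv> pairing c (kernel_comb K d)"

lemma pairing_eq_sum:
  assumes "finite F" "{i. c i \<noteq> 0} \<subseteq> F"
  shows "pairing c g = (\<Sum>i\<in>F. cnj (c i) * g i)"
  unfolding pairing_def by (rule sum.mono_neutral_left) (use assms in auto)

lemma kernel_comb_eq_sum:
  assumes "finite F" "{i. c i \<noteq> 0} \<subseteq> F"
  shows "kernel_comb K c i = (\<Sum>j\<in>F. K i j * c j)"
  unfolding kernel_comb_def by (rule sum.mono_neutral_left) (use assms in auto)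

lemma fin_supp_zero [simp]: "(\<lambda>_. 0) \<in> fin_supp S"
  by (simp add: fin_supp_def)

lemma fin_supp_lincomb:
  assumes "c \<in> fin_supp S" "d \<in> fin_supp S"
  shows "(\<lambda>i. c i + t * d i) \<in> fin_supp S"
proof -
  have "{i. c i + t * d i \<noteq> 0} \<subseteq> {i. c i \<noteq> 0} \<union> {i. d i \<noteq> 0}" by auto
  then show ?thesis using assms unfolding fin_supp_def
    by (auto intro: finite_subset)
qed

lemma fin_supp_mono: "S \<subseteq> T \<Longrightarrow> c \<in> fin_supp S \<Longrightarrow> c \<in> fin_supp T"
  by (auto simp: fin_supp_def)

lemma pairing_lincomb:
  assumes "c \<in> fin_supp S" "d \<in> fin_supp S"
  shows "pairing (\<lambda>i. c i + t * d i) g = pairing c g + cnj t * pairing d g"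
proof -
  let ?F = "{i. c i \<noteq> 0} \<union> {i. d i \<noteq> 0}"
  have F: "finite ?F" using assms by (auto simp: fin_supp_def)
  show ?thesis
    by (subst (1 2 3) pairing_eq_sum[OF F]) (auto simp: sum.distrib sum_distrib_left algebra_simps)
qed

lemma kernel_comb_lincomb:
  assumes "c \<in> fin_supp S" "d \<in> fin_supp S"
  shows "kernel_comb K (\<lambda>i. c i + t * d i) = (\<lambda>i. kernel_comb K c i + t * kernel_comb K d i)"
proof
  fix i
  let ?F = "{i. c i \<noteq> 0} \<union> {i. d i \<noteq> 0}"
  have F: "finite ?F" using assms by (auto simp: fin_supp_def)
  show "kernel_comb K (\<lambda>i. c i + t * d i) i = kernel_comb K c i + t * kernel_comb K d i"
    by (subst (1 2 3) kernel_comb_eq_sum[OF F]) (auto simp: sum.distrib sum_distrib_left algebra_simps)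
qed

lemma pairing_right_lincomb: "pairing c (\<lambda>i. g i + t * h i) = pairing c g + t * pairing c h"
  by (simp add: pairing_def sum.distrib sum_distrib_left algebra_simps)

lemma pairing_right_diff: "pairing c (\<lambda>i. g i - h i) = pairing c g - pairing c h"
  by (simp add: pairing_def sum_subtractf algebra_simps)

lemma pairing_cong:
  assumes "c \<in> fin_supp S" "\<And>i. i \<in> S \<Longrightarrow> g i = h i"
  shows "pairing c g = pairing c h"
  unfolding pairing_def by (rule sum.cong) (use assms in \<open>auto simp: fin_supp_def\<close>)

lemma hform_eq_sum:
  assumes "finite F" "{i. c i \<noteq> 0} \<subseteq> F" "{i. d i \<noteq> 0} \<subseteq> F"
  shows "hform K c d = (\<Sum>i\<in>F. \<Sum>j\<in>F. cnj (c i) * K i j * d j)"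
  by (simp add: pairing_eq_sum[OF assms(1,2)] kernel_comb_eq_sum[OF assms(1,3)] sum_distrib_left mult_ac)

lemma hform_hermitian:
  assumes K: "psd_on S K" and c: "c \<in> fin_supp S" and d: "d \<in> fin_supp S"
  shows "hform K d c = cnj (hform K c d)"
proof -
  let ?F = "{i. c i \<noteq> 0} \<union> {i. d i \<noteq> 0}"
  have F: "finite ?F" and FS: "?F \<subseteq> S" using c d by (auto simp: fin_supp_def)
  have "hform K d c = (\<Sum>i\<in>?F. \<Sum>j\<in>?F. cnj (d i) * K i j * c j)"
    by (rule hform_eq_sum[OF F]) auto
  also have "\<dots> = (\<Sum>i\<in>?F. \<Sum>j\<in>?F. cnj (d j) * K j i * c i)" by (rule sum.swap)
  also have "\<dots> = (\<Sum>i\<in>?F. \<Sum>j\<in>?F. cnj (cnj (c i) * K i j * d j))"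
  proof (intro sum.cong refl)
    fix i j assume "i \<in> ?F" "j \<in> ?F"
    then have "K j i = cnj (K i j)" using psd_on_hermitian[OF K, of i j] FS by blast
    then show "cnj (d j) * K j i * c i = cnj (cnj (c i) * K i j * d j)" by simp
  qed
  also have "\<dots> = cnj (hform K c d)"
    by (subst hform_eq_sum[OF F]) auto
  finally show ?thesis .
qed

lemma hform_nonneg:
  assumes K: "psd_on S K" and c: "c \<in> fin_supp S"
  shows "0 \<le> hform K c c"
proof -
  have F: "finite {i. c i \<noteq> 0}" and FS: "{i. c i \<noteq> 0} \<subseteq> S" using c by (auto simp: fin_supp_def)
  show ?thesis by (subst hform_eq_sum[OF F]) (use psd_onD[OF K F FS] in auto)
qed

lemma psd_onI_hform:
  fixes S :: "'i set"
  assumes "\<And>c. c \<in> fin_supp S \<Longrightarrow> 0 \<le> hform K c c"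
  shows "psd_on S K"
  unfolding psd_on_def
proof (intro allI impI)
  fix F :: "'i set" and c :: "'i \<Rightarrow> complex" assume F: "finite F" "F \<subseteq> S"
  define d where "d i = (if i \<in> F then c i else 0)" for i
  have d: "{i. d i \<noteq> 0} \<subseteq> F" by (auto simp: d_def)
  then have "d \<in> fin_supp S" using F by (auto simp: fin_supp_def intro: finite_subset)
  from assms[OF this] show "0 \<le> (\<Sum>i\<in>F. \<Sum>j\<in>F. cnj (c i) * K i j * c j)"
    by (simp add: hform_eq_sum[OF F(1) d d] d_def cong: sum.cong_simp)
qed

lemma Re_hform_lincomb:
  assumes K: "psd_on S K" and c: "c \<in> fin_supp S" and d: "d \<in> fin_supp S"
  shows "Re (hform K (\<lambda>i. c i + t * d i) (\<lambda>i. c i + t * d i))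
       = Re (hform K c c) + 2 * Re (cnj t * hform K d c) + (cmod t)\<^sup>2 * Re (hform K d d)"
proof -
  have "hform K (\<lambda>i. c i + t * d i) (\<lambda>i. c i + t * d i)
      = hform K c c + cnj (cnj t * hform K d c) + (cnj t * hform K d c + (cnj t * t) * hform K d d)"
    by (simp add: pairing_lincomb[OF c d] kernel_comb_lincomb[OF c d] pairing_right_lincomb
        hform_hermitian[OF K d c] algebra_simps)
  moreover have "Re (cnj t * t * hform K d d) = (cmod t)\<^sup>2 * Re (hform K d d)"
    unfolding cmod_power2 by (simp add: power2_eq_square algebra_simps)
  ultimately show ?thesis by simp
qed

text \<open>
A function \<open>g\<close> on which the pairing is bounded belongs to the reproducing kernel Hilbert space of \<open>K\<close>;
without that space one can still say that combinations of sections come arbitrarily close to \<open>g\<close> in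
norm, the norm of \<open>kernel_comb K c - g\<close> being expressed by duality. As in the usual proof of the Riesz
theorem, \<open>c\<close> almost minimises \<open>J c = \<parallel>c\<parallel>\<^sup>2 - 2 Re (pairing c g)\<close>; here \<open>J\<close> is the squared distance from
\<open>c\<close> to \<open>g\<close> up to a constant, and the first variation of \<open>J\<close> at \<open>c\<close> is small because \<open>J\<close> cannot
decrease by more than \<open>\<epsilon>\<close>.
\<close>

lemma approximate_riesz:
  assumes K: "psd_on S K" and A: "0 \<le> A"
    and bd: "\<And>c. c \<in> fin_supp S \<Longrightarrow> (cmod (pairing c g))\<^sup>2 \<le> A * Re (hform K c c)"
    and \<epsilon>: "0 < \<epsilon>"
  shows "\<exists>c\<in>fin_supp S. \<forall>d\<in>fin_supp S. (cmod (pairing d (\<lambda>i. kernel_comb K c i - g i)))\<^sup>2 \<le> \<epsilon> * Re (hform K d d)"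
proof -
  define J where "J c = Re (hform K c c) - 2 * Re (pairing c g)" for c
  \<comment> \<open>This is \<open>\<parallel>c\<parallel>\<^sup>2 + A \<ge> 2 * sqrt A * \<parallel>c\<parallel>\<close>, the inequality of the means.\<close>
  have below: "- A \<le> J c" if c: "c \<in> fin_supp S" for c
  proof -
    let ?q = "Re (hform K c c)"
    have q: "0 \<le> ?q" using hform_nonneg[OF K c] by (simp add: complex_nonneg_iff)
    have "(2 * cmod (pairing c g))\<^sup>2 \<le> 4 * (A * ?q)" using bd[OF c] by (simp add: power_mult_distrib)
    also have "\<dots> \<le> (A + ?q)\<^sup>2" using zero_le_power2[of "A - ?q"] by (simp add: power2_eq_square algebra_simps)
    finally have "2 * cmod (pairing c g) \<le> A + ?q" by (rule power2_le_imp_le) (use A q in simp)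
    then show ?thesis using complex_Re_le_cmod[of "pairing c g"] by (simp add: J_def)
  qed
  define s where "s = Inf (J ` fin_supp S)"
  have bdd: "bdd_below (J ` fin_supp S)" using below by (auto simp: bdd_below_def)
  have ne: "J ` fin_supp S \<noteq> {}" using fin_supp_zero[of S] by blast
  have "Inf (J ` fin_supp S) < s + \<epsilon>" using \<epsilon> by (simp add: s_def)
  then obtain c where c: "c \<in> fin_supp S" "J c < s + \<epsilon>"
    using cInf_lessD[OF ne] by blast
  have "(cmod (pairing d (\<lambda>i. kernel_comb K c i - g i)))\<^sup>2 \<le> \<epsilon> * Re (hform K d d)" if d: "d \<in> fin_supp S" for d
  proof -
    let ?r = "pairing d (\<lambda>i. kernel_comb K c i - g i)"
    have "0 \<le> \<epsilon> + 2 * Re (t * cnj ?r) + (cmod t)\<^sup>2 * Re (hform K d d)" for t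
    proof -
      have "s \<le> J (\<lambda>i. c i + t * d i)"
        unfolding s_def by (rule cInf_lower[OF _ bdd]) (use fin_supp_lincomb[OF c(1) d] in auto)
      also have "\<dots> = J c + 2 * Re (cnj t * ?r) + (cmod t)\<^sup>2 * Re (hform K d d)"
        unfolding J_def Re_hform_lincomb[OF K c(1) d]
        by (simp add: pairing_lincomb[OF c(1) d] pairing_right_diff algebra_simps)
      finally show ?thesis using c(2) by simp
    qed
    moreover have "0 \<le> Re (hform K d d)" using hform_nonneg[OF K d] by (simp add: complex_nonneg_iff)
    ultimately have "(cmod (cnj ?r))\<^sup>2 \<le> \<epsilon> * Re (hform K d d)"
      by (intro quadratic_nonneg_imp_discriminant)
    then show ?thesis by simp
  qed
  then show ?thesis using c(1) by blast
qed

text \<open>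
The approximating combinations form a Cauchy sequence: testing the difference of two approximations
against itself bounds its norm by the sum of the two errors.
\<close>

lemma approximate_riesz_sequence:
  assumes K: "psd_on S K" and A: "0 \<le> A"
    and bd: "\<And>c. c \<in> fin_supp S \<Longrightarrow> (cmod (pairing c g))\<^sup>2 \<le> A * Re (hform K c c)"
  obtains c where "\<And>n::nat. c n \<in> fin_supp S"
    and "\<And>n d. d \<in> fin_supp S \<Longrightarrow>
           cmod (pairing d (\<lambda>i. kernel_comb K (c n) i - g i)) \<le> inverse (Suc n) * sqrt (Re (hform K d d))"
    and "\<And>m n. Re (hform K (\<lambda>i. c m i - c n i) (\<lambda>i. c m i - c n i))
           \<le> (inverse (Suc m) + inverse (Suc n))\<^sup>2"
proof -
  have "\<exists>c. \<forall>n::nat. c n \<in> fin_supp S \<and> (\<forall>d\<in>fin_supp S.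
     (cmod (pairing d (\<lambda>i. kernel_comb K (c n) i - g i)))\<^sup>2 \<le> (inverse (Suc n))\<^sup>2 * Re (hform K d d))"
    by (intro choice allI) (use approximate_riesz[OF K A bd] in \<open>simp add: Bex_def\<close>)
  then obtain c where c: "\<And>n::nat. c n \<in> fin_supp S"
    and c2: "\<And>n d. d \<in> fin_supp S \<Longrightarrow>
      (cmod (pairing d (\<lambda>i. kernel_comb K (c n) i - g i)))\<^sup>2 \<le> (inverse (Suc n))\<^sup>2 * Re (hform K d d)"
    by blast
  have approx: "cmod (pairing d (\<lambda>i. kernel_comb K (c n) i - g i)) \<le> inverse (Suc n) * sqrt (Re (hform K d d))"
    if "d \<in> fin_supp S" for d n
    using real_sqrt_le_mono[OF c2[OF that, of n]] by (simp add: real_sqrt_mult)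
  have "Re (hform K (\<lambda>i. c m i - c n i) (\<lambda>i. c m i - c n i)) \<le> (inverse (Suc m) + inverse (Suc n))\<^sup>2" for m n
  proof -
    define d where "d = (\<lambda>i. c m i - c n i)"
    have d: "d \<in> fin_supp S" using fin_supp_lincomb[OF c c, of m "-1" n] by (simp add: d_def)
    let ?q = "Re (hform K d d)" and ?e = "inverse (Suc m) + inverse (Suc n) :: real"
    have q: "0 \<le> ?q" using hform_nonneg[OF K d] by (simp add: complex_nonneg_iff)
    have "kernel_comb K d = (\<lambda>i. kernel_comb K (c m) i - kernel_comb K (c n) i)"
      using kernel_comb_lincomb[OF c c, of K m "-1" n] by (simp add: d_def)
    then have "hform K d d = pairing d (\<lambda>i. kernel_comb K (c m) i - g i) - pairing d (\<lambda>i. kernel_comb K (c n) i - g i)"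
      by (simp add: pairing_right_diff)
    then have "?q \<le> cmod (pairing d (\<lambda>i. kernel_comb K (c m) i - g i)) + cmod (pairing d (\<lambda>i. kernel_comb K (c n) i - g i))"
      by (metis complex_Re_le_cmod norm_triangle_ineq4 order_trans)
    also have "\<dots> \<le> ?e * sqrt ?q"
      using approx[OF d, of m] approx[OF d, of n] by (simp add: distrib_right)
    finally have le: "sqrt ?q * sqrt ?q \<le> ?e * sqrt ?q" using q by simp
    have e: "0 \<le> ?e" by simp
    have "sqrt ?q \<le> ?e"
    proof (cases "sqrt ?q = 0")
      case True then show ?thesis using e by simp
    next
      case False
      then have "sqrt ?q > 0" using q by simp
      then show ?thesis using le by (rule mult_right_le_imp_le[rotated])
    qed
    then have "(sqrt ?q)\<^sup>2 \<le> ?e\<^sup>2" using q by (intro power_mono) auto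
    then show ?thesis using q by (simp add: d_def)
  qed
  with c approx show ?thesis by (rule that)
qed

section \<open>Extending contractions\<close>

definition unit_coeff :: "'i \<Rightarrow> 'i \<Rightarrow> complex" where
  "unit_coeff e i = (if i = e then 1 else 0)"

lemma unit_coeff_fin_supp: "e \<in> S \<Longrightarrow> unit_coeff e \<in> fin_supp S"
  by (simp add: fin_supp_def unit_coeff_def)

lemma pairing_unit_coeff [simp]: "pairing (unit_coeff e) g = g e"
  by (subst pairing_eq_sum[of "{e}"]) (auto simp: unit_coeff_def)

lemma kernel_comb_unit_coeff [simp]: "kernel_comb K (unit_coeff e) = (\<lambda>i. K i e)"
  by (rule ext, subst kernel_comb_eq_sum[of "{e}"]) (auto simp: unit_coeff_def)

lemma Re_hform_nonneg: "psd_on S K \<Longrightarrow> c \<in> fin_supp S \<Longrightarrow> 0 \<le> Re (hform K c c)"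
  using hform_nonneg[of S K c] by (simp add: complex_nonneg_iff)

text \<open>
The section of \<open>K\<close> at a further point \<open>e\<close> is a bounded functional, with norm at most that of \<open>e\<close>.
Approximating it by combinations of sections in \<open>S\<close> amounts to projecting \<open>e\<close> onto the closed span
of \<open>S\<close>.
\<close>

lemma pairing_section_bounded:
  assumes K: "psd_on (insert e S) K" and c: "c \<in> fin_supp S"
  shows "(cmod (pairing c (\<lambda>i. K i e)))\<^sup>2 \<le> Re (K e e) * Re (hform K c c)"
proof -
  have c': "c \<in> fin_supp (insert e S)" using c by (rule fin_supp_mono[rotated]) auto
  have e: "unit_coeff e \<in> fin_supp (insert e S)" by (rule unit_coeff_fin_supp) simp
  let ?b = "pairing c (\<lambda>i. K i e)"
  have "0 \<le> Re (K e e) + 2 * Re (t * cnj ?b) + (cmod t)\<^sup>2 * Re (hform K c c)" for t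
  proof -
    have "0 \<le> Re (K e e) + 2 * Re (cnj t * ?b) + (cmod t)\<^sup>2 * Re (hform K c c)"
      using Re_hform_nonneg[OF K fin_supp_lincomb[OF e c'], of t]
      unfolding Re_hform_lincomb[OF K e c'] by simp
    then show ?thesis by simp
  qed
  then have "(cmod (cnj ?b))\<^sup>2 \<le> Re (K e e) * Re (hform K c c)"
    by (intro quadratic_nonneg_imp_discriminant Re_hform_nonneg[OF K c'])
  then show ?thesis by simp
qed

lemma pairing_right_sum: "pairing c (\<lambda>i. \<Sum>a\<in>A. V i a * k a) = (\<Sum>a\<in>A. pairing c (\<lambda>i. V i a) * k a)"
  unfolding pairing_def sum_distrib_left sum_distrib_right
  by (subst sum.swap) (simp add: mult_ac)

lemma hform_minus_gram:
  "hform (\<lambda>i j. K i j - (\<Sum>a\<in>A. V i a * cnj (V j a))) c c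
   = hform K c c - (\<Sum>a\<in>A. of_real ((cmod (pairing c (\<lambda>i. V i a)))\<^sup>2))"
proof -
  have "kernel_comb (\<lambda>i j. K i j - (\<Sum>a\<in>A. V i a * cnj (V j a))) c
      = (\<lambda>i. kernel_comb K c i - (\<Sum>a\<in>A. V i a * cnj (pairing c (\<lambda>i. V i a))))"
    unfolding kernel_comb_def pairing_def cnj_sum sum_distrib_left
    by (subst sum.swap) (simp add: algebra_simps sum_subtractf sum_distrib_left)
  moreover have "pairing c (\<lambda>i. \<Sum>a\<in>A. V i a * cnj (pairing c (\<lambda>i. V i a)))
      = (\<Sum>a\<in>A. pairing c (\<lambda>i. V i a) * cnj (pairing c (\<lambda>i. V i a)))"
    by (rule pairing_right_sum)
  ultimately show ?thesis by (simp only: pairing_right_diff complex_norm_square)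
qed

text \<open>
Subtracting a Gram kernel \<open>V V\<^sup>*\<close> keeps positivity exactly if the (conjugate-linear) map from
coefficients to vectors given by \<open>V\<close> is a contraction for the semi-norm of \<open>K\<close>.
\<close>

lemma psd_on_minus_gram_iff:
  assumes K: "psd_on S K"
  shows "psd_on S (\<lambda>i j. K i j - (\<Sum>a\<in>A. V i a * cnj (V j a))) \<longleftrightarrow>
         (\<forall>c\<in>fin_supp S. (\<Sum>a\<in>A. (cmod (pairing c (\<lambda>i. V i a)))\<^sup>2) \<le> Re (hform K c c))"
    (is "psd_on S ?L \<longleftrightarrow> ?R")
proof
  assume L: "psd_on S ?L"
  show ?R
    using hform_nonneg[OF L] unfolding hform_minus_gram by (auto simp: complex_nonneg_iff)
next
  assume R: ?R
  show "psd_on S ?L"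
  proof (rule psd_onI_hform)
    fix c assume "c \<in> fin_supp S"
    then show "0 \<le> hform ?L c c"
      using R hform_nonneg[OF K, of c] unfolding hform_minus_gram by (auto simp: complex_nonneg_iff)
  qed
qed

lemma convergent_if_dist_le_inverse_Suc:
  fixes x :: "nat \<Rightarrow> complex"
  assumes "\<And>m n. cmod (x m - x n) \<le> inverse (Suc m) + inverse (Suc n)"
  shows "convergent x"
proof (rule Cauchy_convergent, rule CauchyI)
  fix e :: real assume "0 < e"
  then obtain M where M: "inverse (real (Suc M)) < e / 2"
    using reals_Archimedean[of "e / 2"] by auto
  have "cmod (x m - x n) < e" if "M \<le> m" "M \<le> n" for m n
  proof -
    have "inverse (real (Suc m)) \<le> inverse (real (Suc M))" "inverse (real (Suc n)) \<le> inverse (real (Suc M))"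
      using that by (auto intro!: le_imp_inverse_le)
    then show ?thesis using assms[of m n] M by linarith
  qed
  then show "\<exists>M. \<forall>m\<ge>M. \<forall>n\<ge>M. cmod (x m - x n) < e" by blast
qed

text \<open>
Completing the square. It turns an inequality for squared norms into an error of order \<open>e\<close>.
\<close>

lemma le_of_quadratic_le:
  fixes s r e :: real
  assumes "s\<^sup>2 \<le> r\<^sup>2 + 2 * (e * s)" "0 \<le> r" "0 \<le> e"
  shows "s \<le> r + 2 * e"
proof -
  have "0 \<le> r * e" using assms by simp
  then have "(s - e)\<^sup>2 \<le> (r + e)\<^sup>2"
    using assms(1) by (simp add: power2_eq_square algebra_simps)
  then have "s - e \<le> r + e" by (rule power2_le_imp_le) (use assms in simp)
  then show ?thesis by simp
qed

text \<open>
The contraction \<open>T\<close> given by \<open>V\<close> is defined on combinations of points of \<open>S\<close>. Let \<open>p n\<close> be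
combinations converging to the projection of \<open>e\<close>. They form a Cauchy sequence, so \<open>T (p n)\<close> converges,
and \<open>T e\<close> is defined to be the limit. The extension is the old contraction after the projection,
which does not increase norms, so it is again a contraction.
\<close>

lemma contraction_extends_to_point:
  assumes C: "psd_on (insert e S) C" and e: "e \<notin> S" and A: "finite A"
    and V: "psd_on S (\<lambda>i j. C i j - (\<Sum>a\<in>A. V i a * cnj (V j a)))"
  shows "\<exists>y. psd_on (insert e S) (\<lambda>i j. C i j - (\<Sum>a\<in>A. (V(e := y)) i a * cnj ((V(e := y)) j a)))"
proof -
  have CS: "psd_on S C" by (rule psd_on_subset[OF C]) auto
  have V': "(\<Sum>a\<in>A. (cmod (pairing c (\<lambda>i. V i a)))\<^sup>2) \<le> Re (hform C c c)" if "c \<in> fin_supp S" for c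
    using V that unfolding psd_on_minus_gram_iff[OF CS] by blast
  have Va: "(cmod (pairing c (\<lambda>i. V i a)))\<^sup>2 \<le> Re (hform C c c)" if "c \<in> fin_supp S" "a \<in> A" for c a
  proof -
    have "(cmod (pairing c (\<lambda>i. V i a)))\<^sup>2 \<le> (\<Sum>a\<in>A. (cmod (pairing c (\<lambda>i. V i a)))\<^sup>2)"
      by (rule member_le_sum) (use that A in auto)
    then show ?thesis using V'[OF that(1)] by simp
  qed
  have Cee: "0 \<le> Re (C e e)" using psd_on_diag[OF C, of e] by (simp add: complex_nonneg_iff)
  obtain p where p: "\<And>n::nat. p n \<in> fin_supp S"
    and approx: "\<And>n d. d \<in> fin_supp S \<Longrightarrow>
       cmod (pairing d (\<lambda>i. kernel_comb C (p n) i - C i e)) \<le> inverse (Suc n) * sqrt (Re (hform C d d))"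
    and Cau: "\<And>m n. Re (hform C (\<lambda>i. p m i - p n i) (\<lambda>i. p m i - p n i))
           \<le> (inverse (Suc m) + inverse (Suc n))\<^sup>2"
    using approximate_riesz_sequence[OF CS Cee pairing_section_bounded[OF C]] by blast
  have "convergent (\<lambda>n. pairing (p n) (\<lambda>i. V i a))" if a: "a \<in> A" for a
  proof (rule convergent_if_dist_le_inverse_Suc)
    fix m n
    have d: "(\<lambda>i. p m i - p n i) \<in> fin_supp S" using fin_supp_lincomb[OF p p, of m "-1" n] by simp
    have "pairing (p m) (\<lambda>i. V i a) - pairing (p n) (\<lambda>i. V i a) = pairing (\<lambda>i. p m i - p n i) (\<lambda>i. V i a)"
      using pairing_lincomb[OF p p, of m "-1" n] by simp
    then have "(cmod (pairing (p m) (\<lambda>i. V i a) - pairing (p n) (\<lambda>i. V i a)))\<^sup>2 \<le> (inverse (Suc m) + inverse (Suc n))\<^sup>2"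
      using order_trans[OF Va[OF d a] Cau[of m n]] by (simp only:)
    then show "cmod (pairing (p m) (\<lambda>i. V i a) - pairing (p n) (\<lambda>i. V i a)) \<le> inverse (Suc m) + inverse (Suc n)"
      by (rule power2_le_imp_le) simp
  qed
  then have "\<exists>y. \<forall>a\<in>A. (\<lambda>n. pairing (p n) (\<lambda>i. V i a)) \<longlonglongrightarrow> y a"
    by (auto simp: convergent_def intro: bchoice)
  then obtain y where y: "\<And>a. a \<in> A \<Longrightarrow> (\<lambda>n. pairing (p n) (\<lambda>i. V i a)) \<longlonglongrightarrow> y a" by blast
  have "(\<Sum>a\<in>A. (cmod (pairing c (\<lambda>i. (V(e := y)) i a)))\<^sup>2) \<le> Re (hform C c c)"
    if c: "c \<in> fin_supp (insert e S)" for c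
  proof -
    let ?l = "c e" and ?u = "unit_coeff e"
    define d where "d = c(e := 0)"
    have d: "d \<in> fin_supp S" using c e by (auto simp: d_def fin_supp_def elim: finite_subset[rotated])
    have u: "?u \<in> fin_supp (insert e S)" by (rule unit_coeff_fin_supp) simp
    have c_eq: "c = (\<lambda>i. d i + ?l * ?u i)" by (auto simp: d_def unit_coeff_def)
    have d': "d \<in> fin_supp (insert e S)" using d by (rule fin_supp_mono[rotated]) auto
    have pc: "pairing c (\<lambda>i. (V(e := y)) i a) = pairing d (\<lambda>i. V i a) + cnj ?l * y a" for a
      by (subst c_eq, subst pairing_lincomb[OF d' u])
         (use e in \<open>auto intro!: pairing_cong[OF d]\<close>)
    \<comment> \<open>The vector \<open>w n\<close> is \<open>c\<close> with \<open>e\<close> replaced by its approximate projection. Asymptotically it is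
      orthogonal to \<open>c - w n\<close>, hence not longer than \<open>c\<close>.\<close>
    define w where "w n = (\<lambda>i. d i + ?l * p n i)" for n
    have w: "w n \<in> fin_supp S" for n unfolding w_def by (rule fin_supp_lincomb[OF d p])
    let ?q = "Re (hform C c c)"
    have q: "0 \<le> ?q" by (rule Re_hform_nonneg[OF C c])
    have key: "Re (hform C (w n) (w n)) \<le> (sqrt ?q + 2 * (cmod ?l * inverse (Suc n)))\<^sup>2" for n
    proof -
      let ?s = "sqrt (Re (hform C (w n) (w n)))" and ?e = "cmod ?l * inverse (Suc n)"
      define r where "r = (\<lambda>i. ?u i - p n i)"
      have p': "p n \<in> fin_supp (insert e S)" and w': "w n \<in> fin_supp (insert e S)"
        using p w by (auto intro: fin_supp_mono[rotated])
      have r: "r \<in> fin_supp (insert e S)"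
        using fin_supp_lincomb[OF u p', of "-1"] by (simp add: r_def)
      have "c = (\<lambda>i. w n i + ?l * r i)"
        by (subst c_eq) (simp add: w_def r_def algebra_simps)
      then have "?q = Re (hform C (w n) (w n)) + 2 * Re (cnj ?l * hform C r (w n)) + (cmod ?l)\<^sup>2 * Re (hform C r r)"
        using Re_hform_lincomb[OF C w' r, of ?l] by simp
      moreover have "0 \<le> (cmod ?l)\<^sup>2 * Re (hform C r r)"
        using Re_hform_nonneg[OF C r] by simp
      moreover have "- Re (cnj ?l * hform C r (w n)) \<le> ?e * ?s"
      proof -
        have "kernel_comb C r = (\<lambda>i. C i e - kernel_comb C (p n) i)"
          using kernel_comb_lincomb[OF u p', of C "-1"] by (simp add: r_def)
        then have "hform C (w n) r = - pairing (w n) (\<lambda>i. kernel_comb C (p n) i - C i e)"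
          by (simp add: pairing_right_diff)
        then have "cmod (hform C r (w n)) \<le> inverse (Suc n) * ?s"
          using approx[OF w, of n n] hform_hermitian[OF C w' r] by simp
        then have "cmod (cnj ?l * hform C r (w n)) \<le> cmod ?l * (inverse (Suc n) * ?s)"
          by (simp only: norm_mult complex_mod_cnj) (rule mult_left_mono, auto)
        moreover have "- Re (cnj ?l * hform C r (w n)) \<le> cmod (cnj ?l * hform C r (w n))"
          using abs_Re_le_cmod[of "cnj ?l * hform C r (w n)"] by linarith
        ultimately show ?thesis by (simp only: mult.assoc)
      qed
      ultimately have "Re (hform C (w n) (w n)) \<le> ?q + 2 * (?e * ?s)" by linarith
      moreover have ss: "Re (hform C (w n) (w n)) = ?s\<^sup>2" using Re_hform_nonneg[OF CS w] by simp
      moreover have "?q = (sqrt ?q)\<^sup>2" using q by simp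
      ultimately have "?s\<^sup>2 \<le> (sqrt ?q)\<^sup>2 + 2 * (?e * ?s)" by (simp only:)
      then have "?s \<le> sqrt ?q + 2 * ?e" by (rule le_of_quadratic_le) (use q in auto)
      then have "?s\<^sup>2 \<le> (sqrt ?q + 2 * ?e)\<^sup>2" by (rule power_mono) (use Re_hform_nonneg[OF CS w] in simp)
      then show ?thesis using ss by simp
    qed
    have "(\<lambda>n. \<Sum>a\<in>A. (cmod (pairing (w n) (\<lambda>i. V i a)))\<^sup>2)
        \<longlonglongrightarrow> (\<Sum>a\<in>A. (cmod (pairing d (\<lambda>i. V i a) + cnj ?l * y a))\<^sup>2)"
      unfolding w_def pairing_lincomb[OF d p] by (intro tendsto_intros y)
    moreover have "(\<lambda>n. (sqrt ?q + 2 * (cmod ?l * inverse (Suc n)))\<^sup>2) \<longlonglongrightarrow> (sqrt ?q + 2 * (cmod ?l * 0))\<^sup>2"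
      by (intro tendsto_intros LIMSEQ_inverse_real_of_nat)
    moreover have "(\<Sum>a\<in>A. (cmod (pairing (w n) (\<lambda>i. V i a)))\<^sup>2) \<le> (sqrt ?q + 2 * (cmod ?l * inverse (Suc n)))\<^sup>2" for n
      using V'[OF w, of n] key[of n] by linarith
    ultimately have "(\<Sum>a\<in>A. (cmod (pairing d (\<lambda>i. V i a) + cnj ?l * y a))\<^sup>2) \<le> (sqrt ?q + 2 * (cmod ?l * 0))\<^sup>2"
      by (intro LIMSEQ_le) auto
    then show ?thesis unfolding pc using q by simp
  qed
  then show ?thesis unfolding psd_on_minus_gram_iff[OF C] by blast
qed

lemma contraction_extends:
  assumes "finite E" and C: "psd_on (S \<union> E) C" and "S \<inter> E = {}" and A: "finite A"
    and V: "psd_on S (\<lambda>i j. C i j - (\<Sum>a\<in>A. V i a * cnj (V j a)))"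
  shows "\<exists>V'. (\<forall>i\<in>S. V' i = V i) \<and>
      psd_on (S \<union> E) (\<lambda>i j. C i j - (\<Sum>a\<in>A. V' i a * cnj (V' j a)))"
  using assms(1-3)
proof (induction E rule: finite_induct)
  case empty
  then show ?case using V by auto
next
  case (insert e E)
  have "psd_on (S \<union> E) C" by (rule psd_on_subset[OF insert.prems(1)]) auto
  from insert.IH[OF this] insert.prems(2) obtain V' where
    V': "\<forall>i\<in>S. V' i = V i" "psd_on (S \<union> E) (\<lambda>i j. C i j - (\<Sum>a\<in>A. V' i a * cnj (V' j a)))" by auto
  have "psd_on (insert e (S \<union> E)) C" using insert.prems(1) by simp
  from contraction_extends_to_point[OF this _ A V'(2)] insert obtain y where
    y: "psd_on (insert e (S \<union> E)) (\<lambda>i j. C i j - (\<Sum>a\<in>A. (V'(e := y)) i a * cnj ((V'(e := y)) j a)))"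
    by auto
  then show ?case using V'(1) insert by (intro exI[of _ "V'(e := y)"]) auto
qed

section \<open>Extending interpolants\<close>

text \<open>
The scalar form of the block kernel \<open>l(x,y) I - k(x,y) W\<^sub>x W\<^sub>y\<^sup>*\<close>: an index \<open>((x, M), a)\<close> consists of a
point \<open>x\<close>, a value \<open>M\<close> prescribed there (an \<open>N \<times> N\<close> matrix given by its entries) and a row number \<open>a\<close>.
With the value as part of the index the kernel is fixed, and a partial interpolant is simply a
set \<open>G\<close> of pairs \<open>(x, M)\<close> such that the kernel is positive on \<open>G \<times> {..<N}\<close>. Zorn's lemma applies to
such sets ordered by inclusion. That \<open>G\<close> is the graph of a function is a consequence of positivity,
see \<open>pick_values_unique\<close>.
\<close>

definition pick_kernel ::
  "nat \<Rightarrow> ('x \<Rightarrow> 'x \<Rightarrow> complex) \<Rightarrow> ('x \<Rightarrow> 'x \<Rightarrow> complex) \<Rightarrow>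
   ('x \<times> (nat \<Rightarrow> nat \<Rightarrow> complex)) \<times> nat \<Rightarrow> ('x \<times> (nat \<Rightarrow> nat \<Rightarrow> complex)) \<times> nat \<Rightarrow> complex" where
  "pick_kernel N k l = (\<lambda>((x, M), a) ((y, M'), b).
     l x y * (if a = b then 1 else 0) - k x y * (\<Sum>c<N. M a c * cnj (M' b c)))"

lemma psd_on_delta:
  assumes "\<And>i. i \<in> S \<Longrightarrow> f i < (N::nat)"
  shows "psd_on S (\<lambda>i j. if f i = f j then 1 else 0)"
proof (rule psd_on_cong[OF psd_on_gram[of "{..<N}" S "\<lambda>i r. if r = f i then 1 else 0"]])
  fix i j assume i: "i \<in> S"
  have "(\<Sum>r<N. (if r = f i then 1 else 0) * cnj (if r = f j then 1 else (0::complex)))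
      = (\<Sum>r<N. if r = f i then (if f i = f j then 1 else 0) else 0)"
    by (rule sum.cong) auto
  also have "\<dots> = (if f i = f j then 1 else 0)"
    using assms[OF i] by (subst sum.delta) auto
  finally show "(if f i = f j then 1 else 0)
      = (\<Sum>r<N. (if r = f i then 1 else 0) * cnj (if r = f j then 1 else (0::complex)))" ..
qed simp

text \<open>
The completion argument described at the beginning; \<open>R\<close> is the Gram kernel \<open>W W\<^sup>*\<close> and \<open>\<delta>\<close> is the
identity matrix.
\<close>

lemma pick_one_point_extension:
  fixes k l :: "'x \<Rightarrow> 'x \<Rightarrow> complex"
  assumes K: "psd_on UNIV k" and L: "psd_on UNIV l" and P: "psd_on UNIV p"
    and nz: "k z z \<noteq> 0" "l z z \<noteq> 0"
    and lp: "psd_on UNIV (\<lambda>w v. reduced_kernel l z w v - p w v * l w v)"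
    and pk: "psd_on UNIV (\<lambda>w v. p w v * k w v - reduced_kernel k z w v)"
    and G: "psd_on (G \<times> {..<N}) (pick_kernel N k l)"
    and z: "z \<notin> fst ` G"
  shows "\<exists>M. psd_on (insert (z, M) G \<times> {..<N}) (pick_kernel N k l)"
proof -
  let ?S = "G \<times> {..<N}" and ?E = "(\<lambda>b. ((z, \<lambda>_ _. 0), b)) ` {..<N}"
  define pt :: "('x \<times> (nat \<Rightarrow> nat \<Rightarrow> complex)) \<times> nat \<Rightarrow> 'x" where "pt i = fst (fst i)" for i
  define R :: "('x \<times> (nat \<Rightarrow> nat \<Rightarrow> complex)) \<times> nat \<Rightarrow> ('x \<times> (nat \<Rightarrow> nat \<Rightarrow> complex)) \<times> nat \<Rightarrow> complex" where
    "R i j = (\<Sum>c<N. snd (fst i) (snd i) c * cnj (snd (fst j) (snd j) c))" for i j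
  define \<delta> :: "('x \<times> (nat \<Rightarrow> nat \<Rightarrow> complex)) \<times> nat \<Rightarrow> ('x \<times> (nat \<Rightarrow> nat \<Rightarrow> complex)) \<times> nat \<Rightarrow> complex" where
    "\<delta> i j = (if snd i = snd j then 1 else 0)" for i j
  let ?kz = "reduced_kernel k z" and ?lz = "reduced_kernel l z"
  have pick: "pick_kernel N k l i j = l (pt i) (pt j) * \<delta> i j - k (pt i) (pt j) * R i j" for i j
    by (simp add: pick_kernel_def pt_def R_def \<delta>_def split: prod.split)
  obtain u where u: "\<And>x y. k x z * k z y / k z z = u x * cnj (u y)" and uz: "u z \<noteq> 0"
    using psd_on_section_factor[OF K, of z] nz by auto
  obtain v where v: "\<And>x y. l x z * l z y / l z z = v x * cnj (v y)" and "v z \<noteq> 0"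
    using psd_on_section_factor[OF L, of z] nz by auto
  have lz: "?lz x y = l x y - v x * cnj (v y)" and kz: "?kz x y = k x y - u x * cnj (u y)" for x y
    by (simp_all only: reduced_kernel_def u v)
  have vanish: "?kz x y = 0" "?lz x y = 0" if "x = z \<or> y = z" for x y
    using nz that by (auto simp: reduced_kernel_def)
  have pull: "psd_on T (\<lambda>i j. h (pt i) (pt j))" if "psd_on UNIV h" for T h
    by (rule psd_on_pullback[OF that]) simp
  have psd_\<delta>: "psd_on T \<delta>" if "T \<subseteq> UNIV \<times> {..<N}" for T
    unfolding \<delta>_def by (rule psd_on_delta) (use that in auto)
  have psd_R: "psd_on T R" for T unfolding R_def by (rule psd_on_gram) simp

  have "psd_on ?S (\<lambda>i j. (?lz (pt i) (pt j) - p (pt i) (pt j) * l (pt i) (pt j)) * \<delta> i j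
      + (p (pt i) (pt j) * k (pt i) (pt j) - ?kz (pt i) (pt j)) * R i j
      + p (pt i) (pt j) * pick_kernel N k l i j)"
    by (intro psd_on_add psd_on_schur_product pull[OF lp] pull[OF pk] pull[OF P] G psd_R psd_\<delta>) auto
  then have "psd_on ?S (\<lambda>i j. ?lz (pt i) (pt j) * \<delta> i j - ?kz (pt i) (pt j) * R i j)"
    by (rule psd_on_cong) (simp add: pick algebra_simps)
  \<comment> \<open>Both reduced kernels vanish at \<open>z\<close>, so the values attached to the indices in \<open>?E\<close> are placeholders
    without influence.\<close>
  then have red: "psd_on (?S \<union> ?E) (\<lambda>i j. ?lz (pt i) (pt j) * \<delta> i j - ?kz (pt i) (pt j) * R i j)"
    by (rule psd_on_zero_extension) (auto simp: pt_def vanish)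
  define C where "C i j = l (pt i) (pt j) * \<delta> i j - ?kz (pt i) (pt j) * R i j" for i j
  have vv: "psd_on (?S \<union> ?E) (\<lambda>i j. v (pt i) * cnj (v (pt j)))"
    using psd_on_gram[of "{0::nat}" "?S \<union> ?E" "\<lambda>i r. v (pt i)"] by simp
  have "psd_on (?S \<union> ?E) (\<lambda>i j. (?lz (pt i) (pt j) * \<delta> i j - ?kz (pt i) (pt j) * R i j)
      + v (pt i) * cnj (v (pt j)) * \<delta> i j)"
    by (rule psd_on_add[OF red psd_on_schur_product[OF vv psd_\<delta>]]) auto
  then have C: "psd_on (?S \<union> ?E) C"
    by (rule psd_on_cong) (simp add: C_def lz algebra_simps)

  define V where "V i c = u (pt i) * snd (fst i) (snd i) c" for i and c :: nat
  have VV: "(\<Sum>c<N. V i c * cnj (V j c)) = u (pt i) * cnj (u (pt j)) * R i j" for i j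
    by (simp add: V_def R_def sum_distrib_left mult_ac)
  have pick_CV: "pick_kernel N k l i j = C i j - (\<Sum>c<N. V i c * cnj (V j c))" for i j
    by (simp add: pick C_def VV kz algebra_simps)
  have CV: "psd_on ?S (\<lambda>i j. C i j - (\<Sum>c<N. V i c * cnj (V j c)))"
    by (rule psd_on_cong[OF G]) (simp add: pick_CV)
  have "?S \<inter> ?E = {}" using z by force
  from contraction_extends[OF _ C this _ CV] obtain V' where
    V'S: "\<And>i. i \<in> ?S \<Longrightarrow> V' i = V i"
    and V': "psd_on (?S \<union> ?E) (\<lambda>i j. C i j - (\<Sum>c<N. V' i c * cnj (V' j c)))" by auto
  \<comment> \<open>The factor at \<open>z\<close> is non-zero, so the row of \<open>V\<close> found at \<open>z\<close> determines the value there.\<close>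
  define M where "M a c = V' ((z, \<lambda>_ _. 0), a) c / u z" for a c
  \<comment> \<open>Exchange the placeholder at \<open>z\<close> for the value \<open>M\<close>.\<close>
  define f where "f = (\<lambda>i. if pt i = z then ((z, \<lambda>_ _. 0::complex), snd i) else i)"
  have ins: "pt i = z \<and> fst i = (z, M) \<and> snd i < N \<or> i \<in> ?S \<and> pt i \<noteq> z"
    if "i \<in> insert (z, M) G \<times> {..<N}" for i
    using that z by (force simp: pt_def)
  have "f ` (insert (z, M) G \<times> {..<N}) \<subseteq> ?S \<union> ?E"
    using ins by (fastforce simp: f_def)
  from psd_on_pullback[OF V' this]
  have "psd_on (insert (z, M) G \<times> {..<N}) (\<lambda>i j. C (f i) (f j) - (\<Sum>c<N. V' (f i) c * cnj (V' (f j) c)))" .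
  then have "psd_on (insert (z, M) G \<times> {..<N}) (pick_kernel N k l)"
  proof (rule psd_on_cong)
    fix i j assume i: "i \<in> insert (z, M) G \<times> {..<N}" and j: "j \<in> insert (z, M) G \<times> {..<N}"
    have V'f: "V' (f i) = V i" if "i \<in> insert (z, M) G \<times> {..<N}" for i
    proof (cases "pt i = z")
      case True
      then have "fst i = (z, M)" using ins[OF that] z by (auto simp: pt_def)
      then show ?thesis using True uz by (auto simp: f_def V_def M_def pt_def)
    next
      case False
      then show ?thesis using ins[OF that] V'S by (auto simp: f_def)
    qed
    have ptf: "pt (f i) = pt i" "snd (f i) = snd i" for i by (auto simp: f_def pt_def)
    have "C (f i) (f j) = C i j"
    proof (cases "pt i = z \<or> pt j = z")
      case True
      then show ?thesis by (auto simp: C_def ptf vanish \<delta>_def)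
    next
      case False
      then show ?thesis by (simp add: f_def)
    qed
    then show "pick_kernel N k l i j = C (f i) (f j) - (\<Sum>c<N. V' (f i) c * cnj (V' (f j) c))"
      by (simp add: pick_CV V'f[OF i] V'f[OF j])
  qed
  then show ?thesis by blast
qed

text \<open>
Positivity is a condition on finite subsets, so it is inherited by unions of chains; by
assumption a maximal set lacks no point.
\<close>

lemma pick_total_extension:
  assumes step: "\<And>G z. psd_on (G \<times> {..<N}) (pick_kernel N k l) \<Longrightarrow> z \<notin> fst ` G \<Longrightarrow>
      \<exists>M. psd_on (insert (z, M) G \<times> {..<N}) (pick_kernel N k l)"
    and G0: "psd_on (G0 \<times> {..<N}) (pick_kernel N k l)"
  shows "\<exists>G. G0 \<subseteq> G \<and> psd_on (G \<times> {..<N}) (pick_kernel N k l) \<and> fst ` G = UNIV"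
proof -
  let ?A = "{G. G0 \<subseteq> G \<and> psd_on (G \<times> {..<N}) (pick_kernel N k l)}"
  have "\<exists>M\<in>?A. \<forall>X\<in>?A. M \<subseteq> X \<longrightarrow> X = M"
  proof (rule subset_Zorn_nonempty)
    show "?A \<noteq> {}" using G0 by blast
    fix \<C> assume ne: "\<C> \<noteq> {}" and ch: "subset.chain ?A \<C>"
    have sub: "\<C> \<subseteq> ?A" using ch by (simp add: subset.chain_def)
    have "psd_on (\<Union>\<C> \<times> {..<N}) (pick_kernel N k l)"
      unfolding psd_on_def
    proof (intro allI impI)
      fix F c assume F: "finite F" "F \<subseteq> \<Union>\<C> \<times> {..<N}"
      have "finite (fst ` F)" "fst ` F \<subseteq> \<Union>\<C>" using F by auto
      then obtain G where "G \<in> \<C>" "fst ` F \<subseteq> G"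
        using finite_subset_Union_chain[OF _ _ ne ch] by metis
      then have "F \<subseteq> G \<times> {..<N}" "psd_on (G \<times> {..<N}) (pick_kernel N k l)"
        using F(2) sub by force+
      then show "0 \<le> (\<Sum>i\<in>F. \<Sum>j\<in>F. cnj (c i) * pick_kernel N k l i j * c j)"
        using psd_onD F(1) by blast
    qed
    then show "\<Union>\<C> \<in> ?A" using sub ne by blast
  qed
  then obtain G where "G \<in> ?A" and max: "\<forall>X\<in>?A. G \<subseteq> X \<longrightarrow> X = G" ..
  then have G: "G0 \<subseteq> G" "psd_on (G \<times> {..<N}) (pick_kernel N k l)" by simp_all
  have "z \<in> fst ` G" for z
  proof (rule ccontr)
    assume z: "z \<notin> fst ` G"
    from step[OF G(2) z] obtain M where "psd_on (insert (z, M) G \<times> {..<N}) (pick_kernel N k l)" ..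
    then have "insert (z, M) G \<in> ?A" using G(1) by auto
    then have "insert (z, M) G = G" using max by auto
    then show False using z by force
  qed
  then show ?thesis using G by blast
qed

text \<open>
Test the kernel with the coefficients 1 and -1 at the two indices over the same point and row: the
contributions of \<open>l\<close> cancel, and what remains is \<open>- k(x,x)\<close> times the squared distance of the two
rows.
\<close>

lemma pick_values_unique:
  assumes G: "psd_on (G \<times> {..<N}) (pick_kernel N k l)" and M: "(x, M) \<in> G" "(x, M') \<in> G"
    and k: "0 \<le> k x x" "k x x \<noteq> 0" and ac: "a < N" "c < N"
  shows "M a c = M' a c"
proof (cases "M = M'")
  case False
  let ?i = "((x, M), a)" and ?j = "((x, M'), a)"
  let ?s = "\<Sum>c<N. (cmod (M a c - M' a c))\<^sup>2"
  have pos: "0 < Re (k x x)" and Im: "Im (k x x) = 0"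
    using k by (auto simp: complex_nonneg_iff complex_eq_iff less_le)
  have "0 \<le> (\<Sum>i\<in>{?i, ?j}. \<Sum>j\<in>{?i, ?j}.
      cnj (if i = ?i then 1 else - 1) * pick_kernel N k l i j * (if j = ?i then 1 else - 1))"
    by (rule psd_onD[OF G]) (use M ac in auto)
  also have "\<dots> = - k x x * (\<Sum>c<N. (M a c - M' a c) * cnj (M a c - M' a c))"
    using False by (simp add: pick_kernel_def algebra_simps sum.distrib sum_subtractf)
  also have "\<dots> = - k x x * of_real ?s" by (simp only: complex_norm_square of_real_sum)
  finally have "Re (k x x) * ?s \<le> 0" using Im by (simp add: complex_nonneg_iff)
  then have "?s \<le> 0" using pos by (simp add: mult_le_0_iff)
  moreover have "(cmod (M a c - M' a c))\<^sup>2 \<le> ?s"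
    by (rule member_le_sum) (use ac in auto)
  ultimately have "(cmod (M a c - M' a c))\<^sup>2 \<le> 0" by linarith
  then show ?thesis by simp
qed simp

section \<open>Contractive multipliers\<close>

lemma LIMSEQ_zero_if_norm_le:
  fixes f :: "nat \<Rightarrow> complex"
  assumes "\<And>n. cmod (f n) \<le> g n" "g \<longlonglongrightarrow> 0"
  shows "f \<longlonglongrightarrow> 0"
  by (rule tendsto_norm_zero_cancel, rule tendsto_sandwich[OF _ _ tendsto_const assms(2)])
     (use assms(1) in auto)

locale reproducing_space =
  fixes k :: "'x \<Rightarrow> 'x \<Rightarrow> complex" and H ip
  assumes rkhs: "rkhs k H ip"
begin

lemma zero_mem: "(\<lambda>x. 0) \<in> H"
  and add_mem [rule_format]: "\<forall>f\<in>H. \<forall>g\<in>H. (\<lambda>x. f x + g x) \<in> H"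
  and scale_mem [rule_format]: "\<forall>a. \<forall>f\<in>H. (\<lambda>x. a * f x) \<in> H"
  and ip_add [rule_format]:
    "\<forall>f\<in>H. \<forall>g\<in>H. \<forall>h\<in>H. ip (\<lambda>x. f x + g x) h = ip f h + ip g h"
  and ip_scale [rule_format]: "\<forall>a. \<forall>f\<in>H. \<forall>g\<in>H. ip (\<lambda>x. a * f x) g = a * ip f g"
  and ip_sym [rule_format]: "\<forall>f\<in>H. \<forall>g\<in>H. ip g f = cnj (ip f g)"
  and ip_nonneg [rule_format]: "\<forall>f\<in>H. 0 \<le> ip f f"
  and section_mem [rule_format]: "\<forall>w. (\<lambda>x. k x w) \<in> H"
  and reproduce [rule_format, symmetric]: "\<forall>f\<in>H. \<forall>w. f w = ip f (\<lambda>x. k x w)"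
  and complete [rule_format]: "\<forall>F::nat \<Rightarrow> 'x \<Rightarrow> complex. (\<forall>n. F n \<in> H) \<longrightarrow>
      (\<forall>e>0. \<exists>M. \<forall>m\<ge>M. \<forall>n\<ge>M. ip_norm ip (\<lambda>x. F m x - F n x) < e) \<longrightarrow>
      (\<exists>f\<in>H. (\<lambda>n. ip_norm ip (\<lambda>x. F n x - f x)) \<longlonglongrightarrow> 0)"
  by (insert rkhs[unfolded rkhs_def], elim conjE, assumption)+

lemma diff_mem: "f \<in> H \<Longrightarrow> g \<in> H \<Longrightarrow> (\<lambda>x. f x - g x) \<in> H"
  using add_mem[of f "\<lambda>x. - 1 * g x"] scale_mem[of g "- 1"] by simp

lemma ip_diff: "f \<in> H \<Longrightarrow> g \<in> H \<Longrightarrow> h \<in> H \<Longrightarrow> ip (\<lambda>x. f x - g x) h = ip f h - ip g h"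
  using ip_add[of f "\<lambda>x. - 1 * g x" h] scale_mem[of g "- 1"] ip_scale[of g h "- 1"] by simp

lemma sum_mem:
  "finite F \<Longrightarrow> (\<And>i. i \<in> F \<Longrightarrow> f i \<in> H) \<Longrightarrow> (\<lambda>x. \<Sum>i\<in>F. c i * f i x) \<in> H"
proof (induction F rule: finite_induct)
  case (insert i F)
  then show ?case using add_mem[OF scale_mem[of "f i" "c i"], of "\<lambda>x. \<Sum>i\<in>F. c i * f i x"] by simp
qed (simp add: zero_mem)

lemma ip_sum:
  assumes "finite F" "\<And>i. i \<in> F \<Longrightarrow> f i \<in> H" "g \<in> H"
  shows "ip (\<lambda>x. \<Sum>i\<in>F. c i * f i x) g = (\<Sum>i\<in>F. c i * ip (f i) g)"
  using assms
proof (induction F rule: finite_induct)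
  case empty
  then show ?case using ip_scale[OF zero_mem, of g 0] by simp
next
  case (insert i F)
  then show ?case by (simp add: ip_add ip_scale scale_mem sum_mem)
qed

text \<open>
Any inner product is a positive semi-definite kernel on the space itself. This makes the
Cauchy--Schwarz inequality for kernels available for \<open>ip\<close>.
\<close>

lemma ip_psd_on: "psd_on H (\<lambda>f g. ip g f)"
  unfolding psd_on_def
proof (intro allI impI)
  fix F and c :: "('x \<Rightarrow> complex) \<Rightarrow> complex" assume F: "finite F" "F \<subseteq> H"
  let ?s = "\<lambda>x. \<Sum>f\<in>F. c f * f x"
  have s: "?s \<in> H" by (rule sum_mem[OF F(1)]) (use F in auto)
  have "ip ?s ?s = (\<Sum>f\<in>F. c f * ip f ?s)" by (rule ip_sum[OF F(1) _ s]) (use F in auto)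
  also have "\<dots> = (\<Sum>f\<in>F. c f * cnj (\<Sum>g\<in>F. c g * ip g f))"
  proof (rule sum.cong[OF refl])
    fix f assume "f \<in> F"
    then have f: "f \<in> H" using F by auto
    have "ip f ?s = cnj (ip ?s f)" by (rule ip_sym[OF s f])
    also have "ip ?s f = (\<Sum>g\<in>F. c g * ip g f)" by (rule ip_sum[OF F(1) _ f]) (use F in auto)
    finally show "c f * ip f ?s = c f * cnj (\<Sum>g\<in>F. c g * ip g f)" by simp
  qed
  also have "\<dots> = (\<Sum>f\<in>F. \<Sum>g\<in>F. cnj (c g) * ip f g * c f)"
    unfolding cnj_sum sum_distrib_left
  proof (intro sum.cong refl)
    fix f g assume "f \<in> F" "g \<in> F"
    then have "ip f g = cnj (ip g f)" using ip_sym F(2) by blast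
    then show "c f * cnj (c g * ip g f) = cnj (c g) * ip f g * c f" by simp
  qed
  also have "\<dots> = (\<Sum>g\<in>F. \<Sum>f\<in>F. cnj (c g) * ip f g * c f)" by (rule sum.swap)
  finally show "0 \<le> (\<Sum>g\<in>F. \<Sum>f\<in>F. cnj (c g) * ip f g * c f)" using ip_nonneg[OF s] by simp
qed

lemma kernel_psd: "psd_on UNIV k"
proof -
  have "psd_on UNIV (\<lambda>w v. ip (\<lambda>x. k x v) (\<lambda>x. k x w))"
    using psd_on_pullback[OF ip_psd_on, of "\<lambda>w x. k x w" UNIV] section_mem by auto
  then show ?thesis by (rule psd_on_cong) (simp add: reproduce[OF section_mem])
qed

lemma ip_norm_nonneg: "f \<in> H \<Longrightarrow> 0 \<le> ip_norm ip f"
  using ip_nonneg[of f] by (simp add: ip_norm_def complex_nonneg_iff)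

lemma ip_norm_sq: "f \<in> H \<Longrightarrow> (ip_norm ip f)\<^sup>2 = Re (ip f f)"
  using ip_nonneg[of f] by (simp add: ip_norm_def complex_nonneg_iff)

lemma ip_self: "f \<in> H \<Longrightarrow> ip f f = of_real ((ip_norm ip f)\<^sup>2)"
  using ip_nonneg[of f] by (subst ip_norm_sq) (auto simp: complex_nonneg_iff complex_eq_iff)

lemma cauchy_schwarz:
  assumes "f \<in> H" "g \<in> H"
  shows "cmod (ip f g) \<le> ip_norm ip f * ip_norm ip g"
proof -
  have "(cmod (ip f g))\<^sup>2 \<le> (ip_norm ip f * ip_norm ip g)\<^sup>2"
    using psd_on_cauchy_schwarz[OF ip_psd_on assms(2,1)] assms
    by (simp add: power_mult_distrib ip_norm_sq mult.commute)
  then show ?thesis by (rule power2_le_imp_le) (simp add: ip_norm_nonneg assms)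
qed

lemma kernel_comb_mem:
  assumes "c \<in> fin_supp S"
  shows "kernel_comb k c \<in> H"
proof -
  have "(\<lambda>x. \<Sum>j | c j \<noteq> 0. c j * k x j) \<in> H"
    by (rule sum_mem) (use assms section_mem in \<open>auto simp: fin_supp_def\<close>)
  also have "(\<lambda>x. \<Sum>j | c j \<noteq> 0. c j * k x j) = kernel_comb k c" by (auto simp: kernel_comb_def mult.commute)
  finally show ?thesis .
qed

lemma ip_kernel_comb:
  assumes c: "c \<in> fin_supp S" and g: "g \<in> H"
  shows "ip g (kernel_comb k c) = pairing c g"
proof -
  have "kernel_comb k c = (\<lambda>x. \<Sum>j | c j \<noteq> 0. c j * k x j)" by (auto simp: kernel_comb_def mult.commute)
  then have "ip (kernel_comb k c) g = (\<Sum>j | c j \<noteq> 0. c j * ip (\<lambda>x. k x j) g)"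
    using ip_sum[OF _ section_mem g, of "{j. c j \<noteq> 0}" c "\<lambda>j. j"] c by (simp add: fin_supp_def)
  also have "\<dots> = (\<Sum>j | c j \<noteq> 0. c j * cnj (g j))"
    by (simp only: ip_sym[OF g section_mem] reproduce[OF g] complex_cnj_cnj)
  also have "\<dots> = cnj (pairing c g)" by (simp add: pairing_def)
  finally show ?thesis using ip_sym[OF kernel_comb_mem[OF c] g] by simp
qed

lemma ip_norm_kernel_comb:
  assumes "c \<in> fin_supp S"
  shows "ip_norm ip (kernel_comb k c) = sqrt (Re (hform k c c))"
  by (simp add: ip_norm_def ip_kernel_comb[OF assms kernel_comb_mem[OF assms]])

text \<open>
By completeness the approximating combinations converge in norm, and the limit is \<open>g\<close> because both
modes of convergence imply pointwise convergence.
\<close>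

lemma bounded_functional_mem:
  assumes A: "0 \<le> A"
    and bd: "\<And>c. c \<in> fin_supp UNIV \<Longrightarrow> (cmod (pairing c g))\<^sup>2 \<le> A * Re (hform k c c)"
  shows "g \<in> H"
    and "\<exists>p. (\<forall>n. p n \<in> fin_supp UNIV) \<and> (\<lambda>n. ip_norm ip (\<lambda>x. kernel_comb k (p n) x - g x)) \<longlonglongrightarrow> 0"
proof -
  obtain p where p: "\<And>n::nat. p n \<in> fin_supp UNIV"
    and approx: "\<And>n d. d \<in> fin_supp UNIV \<Longrightarrow>
       cmod (pairing d (\<lambda>i. kernel_comb k (p n) i - g i)) \<le> inverse (Suc n) * sqrt (Re (hform k d d))"
    and Cau: "\<And>m n. Re (hform k (\<lambda>i. p m i - p n i) (\<lambda>i. p m i - p n i))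
           \<le> (inverse (Suc m) + inverse (Suc n))\<^sup>2"
    using approximate_riesz_sequence[OF kernel_psd A bd] by blast
  have dist: "ip_norm ip (\<lambda>x. kernel_comb k (p m) x - kernel_comb k (p n) x) \<le> inverse (Suc m) + inverse (Suc n)" for m n
  proof -
    have d: "(\<lambda>i. p m i - p n i) \<in> fin_supp UNIV" using fin_supp_lincomb[OF p p, of m "-1" n] by simp
    have "(\<lambda>x. kernel_comb k (p m) x - kernel_comb k (p n) x) = kernel_comb k (\<lambda>i. p m i - p n i)"
      using kernel_comb_lincomb[OF p p, of k m "-1" n] by simp
    then have "ip_norm ip (\<lambda>x. kernel_comb k (p m) x - kernel_comb k (p n) x)
        = sqrt (Re (hform k (\<lambda>i. p m i - p n i) (\<lambda>i. p m i - p n i)))"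
      by (simp only: ip_norm_kernel_comb[OF d])
    also have "\<dots> \<le> sqrt ((inverse (Suc m) + inverse (Suc n))\<^sup>2)" by (rule real_sqrt_le_mono[OF Cau])
    also have "\<dots> = inverse (Suc m) + inverse (Suc n)" by (rule real_sqrt_abs[THEN trans]) simp
    finally show ?thesis .
  qed
  have "\<exists>f\<in>H. (\<lambda>n. ip_norm ip (\<lambda>x. kernel_comb k (p n) x - f x)) \<longlonglongrightarrow> 0"
  proof (rule complete[OF kernel_comb_mem[OF p]])
    fix e :: real assume "0 < e"
    then obtain M where M: "inverse (real (Suc M)) < e / 2"
      using reals_Archimedean[of "e / 2"] by auto
    have "ip_norm ip (\<lambda>x. kernel_comb k (p m) x - kernel_comb k (p n) x) < e" if "M \<le> m" "M \<le> n" for m n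
    proof -
      have "inverse (real (Suc m)) \<le> inverse (real (Suc M))" "inverse (real (Suc n)) \<le> inverse (real (Suc M))"
        using that by (auto intro!: le_imp_inverse_le)
      then show ?thesis using dist[of m n] M by linarith
    qed
    then show "\<exists>M. \<forall>m\<ge>M. \<forall>n\<ge>M. ip_norm ip (\<lambda>x. kernel_comb k (p m) x - kernel_comb k (p n) x) < e" by blast
  qed
  then obtain f where f: "f \<in> H" and lim: "(\<lambda>n. ip_norm ip (\<lambda>x. kernel_comb k (p n) x - f x)) \<longlonglongrightarrow> 0" ..
  have "f x = g x" for x
  proof (rule LIMSEQ_unique)
    have sec: "(\<lambda>y. k y x) \<in> H" by (rule section_mem)
    have "cmod (kernel_comb k (p n) x - f x) \<le> ip_norm ip (\<lambda>x. kernel_comb k (p n) x - f x) * ip_norm ip (\<lambda>y. k y x)" for n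
      using cauchy_schwarz[OF diff_mem[OF kernel_comb_mem[OF p] f] sec, of n]
      by (simp add: reproduce[OF diff_mem[OF kernel_comb_mem[OF p] f]])
    moreover have "(\<lambda>n. ip_norm ip (\<lambda>x. kernel_comb k (p n) x - f x) * ip_norm ip (\<lambda>y. k y x)) \<longlonglongrightarrow> 0"
      by (rule tendsto_mult_left_zero[OF lim])
    ultimately have "(\<lambda>n. kernel_comb k (p n) x - f x) \<longlonglongrightarrow> 0"
      by (rule LIMSEQ_zero_if_norm_le)
    then show "(\<lambda>n. kernel_comb k (p n) x) \<longlonglongrightarrow> f x" by (simp add: LIM_zero_iff)
    have u: "unit_coeff x \<in> fin_supp UNIV" by (rule unit_coeff_fin_supp) simp
    have "cmod (kernel_comb k (p n) x - g x) \<le> inverse (Suc n) * sqrt (Re (k x x))" for n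
      using approx[OF u, of n] by simp
    moreover have "(\<lambda>n. inverse (real (Suc n)) * sqrt (Re (k x x))) \<longlonglongrightarrow> 0"
      by (rule tendsto_mult_left_zero[OF LIMSEQ_inverse_real_of_nat])
    ultimately have "(\<lambda>n. kernel_comb k (p n) x - g x) \<longlonglongrightarrow> 0"
      by (rule LIMSEQ_zero_if_norm_le)
    then show "(\<lambda>n. kernel_comb k (p n) x) \<longlonglongrightarrow> g x" by (simp add: LIM_zero_iff)
  qed
  then have "f = g" by auto
  then show "g \<in> H"
    and "\<exists>p. (\<forall>n. p n \<in> fin_supp UNIV) \<and> (\<lambda>n. ip_norm ip (\<lambda>x. kernel_comb k (p n) x - g x)) \<longlonglongrightarrow> 0"
    using f lim p by auto
qed

text \<open>
The vector-valued version, in which the sum of the squared norms is bounded by the same constant.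
With \<open>N2\<close> for this sum, choosing combinations \<open>d a\<close> that converge to \<open>g a\<close> gives \<open>N2\<^sup>2 \<le> A * N2\<close> in
the limit.
\<close>

lemma bounded_functional_tuple:
  assumes A: "0 \<le> A" and I: "finite I"
    and bd: "\<And>d. (\<And>a. a \<in> I \<Longrightarrow> d a \<in> fin_supp UNIV) \<Longrightarrow>
       (cmod (\<Sum>a\<in>I. pairing (d a) (g a)))\<^sup>2 \<le> A * (\<Sum>a\<in>I. Re (hform k (d a) (d a)))"
  shows "\<And>a. a \<in> I \<Longrightarrow> g a \<in> H" and "(\<Sum>a\<in>I. (ip_norm ip (g a))\<^sup>2) \<le> A"
proof -
  have single: "(cmod (pairing c (g a)))\<^sup>2 \<le> A * Re (hform k c c)" if a: "a \<in> I" and c: "c \<in> fin_supp UNIV" for a c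
  proof -
    have z: "pairing (\<lambda>_. 0) h = 0" for h :: "'x \<Rightarrow> complex" by (simp add: pairing_def)
    have s: "(\<Sum>b\<in>I. if b = a then x else 0) = x" for x :: "'b::comm_monoid_add" using I a by simp
    have "(\<Sum>b\<in>I. pairing (if b = a then c else (\<lambda>_. 0)) (g b)) = (\<Sum>b\<in>I. if b = a then pairing c (g a) else 0)"
      by (rule sum.cong) (auto simp: z)
    moreover have "(\<Sum>b\<in>I. Re (hform k (if b = a then c else (\<lambda>_. 0)) (if b = a then c else (\<lambda>_. 0))))
        = (\<Sum>b\<in>I. if b = a then Re (hform k c c) else 0)"
      by (rule sum.cong) (auto simp: z)
    ultimately show ?thesis
      using bd[of "\<lambda>b. if b = a then c else (\<lambda>_. 0)"] c by (simp add: I a)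
  qed
  then show g: "\<And>a. a \<in> I \<Longrightarrow> g a \<in> H" using bounded_functional_mem(1)[OF A] by blast
  have "\<forall>a\<in>I. \<exists>p. (\<forall>n. p n \<in> fin_supp UNIV) \<and> (\<lambda>n. ip_norm ip (\<lambda>x. kernel_comb k (p n) x - g a x)) \<longlonglongrightarrow> 0"
    using bounded_functional_mem(2)[OF A] single by blast
  then obtain p where p: "\<And>a n. a \<in> I \<Longrightarrow> p a n \<in> fin_supp UNIV"
    and lim: "\<And>a. a \<in> I \<Longrightarrow> (\<lambda>n. ip_norm ip (\<lambda>x. kernel_comb k (p a n) x - g a x)) \<longlonglongrightarrow> 0"
    by (auto dest!: bchoice)
  define N2 where "N2 = (\<Sum>a\<in>I. (ip_norm ip (g a))\<^sup>2)"
  have N2: "0 \<le> N2" by (simp add: N2_def sum_nonneg)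
  have pairing_lim: "(\<lambda>n. pairing (p a n) (g a)) \<longlonglongrightarrow> of_real ((ip_norm ip (g a))\<^sup>2)" if a: "a \<in> I" for a
  proof -
    have m: "kernel_comb k (p a n) \<in> H" for n by (rule kernel_comb_mem[OF p[OF a]])
    have "cmod (cnj (pairing (p a n) (g a)) - of_real ((ip_norm ip (g a))\<^sup>2))
        \<le> ip_norm ip (\<lambda>x. kernel_comb k (p a n) x - g a x) * ip_norm ip (g a)" for n
    proof -
      have "cnj (pairing (p a n) (g a)) - of_real ((ip_norm ip (g a))\<^sup>2) = ip (\<lambda>x. kernel_comb k (p a n) x - g a x) (g a)"
        by (simp only: ip_diff[OF m g[OF a] g[OF a]] ip_kernel_comb[OF p[OF a] g[OF a], symmetric]
            ip_self[OF g[OF a]] ip_sym[OF g[OF a] m, symmetric])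
      then show ?thesis using cauchy_schwarz[OF diff_mem[OF m g[OF a]] g[OF a]] by (simp only:)
    qed
    moreover have "(\<lambda>n. ip_norm ip (\<lambda>x. kernel_comb k (p a n) x - g a x) * ip_norm ip (g a)) \<longlonglongrightarrow> 0"
      by (rule tendsto_mult_left_zero[OF lim[OF a]])
    ultimately have "(\<lambda>n. cnj (pairing (p a n) (g a)) - of_real ((ip_norm ip (g a))\<^sup>2)) \<longlonglongrightarrow> 0"
      by (rule LIMSEQ_zero_if_norm_le)
    then have "(\<lambda>n. cnj (pairing (p a n) (g a))) \<longlonglongrightarrow> of_real ((ip_norm ip (g a))\<^sup>2)"
      by (simp only: LIM_zero_iff)
    from tendsto_cnj[OF this] show ?thesis by simp
  qed
  have hform_lim: "(\<lambda>n. Re (hform k (p a n) (p a n))) \<longlonglongrightarrow> (ip_norm ip (g a))\<^sup>2" if a: "a \<in> I" for a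
  proof -
    have m: "kernel_comb k (p a n) \<in> H" for n by (rule kernel_comb_mem[OF p[OF a]])
    let ?r = "\<lambda>n x. kernel_comb k (p a n) x - g a x"
    have r: "?r n \<in> H" for n by (rule diff_mem[OF m g[OF a]])
    \<comment> \<open>Expand the squared norm of \<open>g a + ?r n\<close> and eliminate the mixed term.\<close>
    have "Re (hform k (p a n) (p a n)) = (ip_norm ip (?r n))\<^sup>2 + 2 * Re (pairing (p a n) (g a)) - (ip_norm ip (g a))\<^sup>2" for n
    proof -
      have "ip (?r n) (?r n) = ip (kernel_comb k (p a n)) (?r n) - ip (g a) (?r n)"
        by (rule ip_diff[OF m g[OF a] r])
      also have "ip (kernel_comb k (p a n)) (?r n) = cnj (ip (kernel_comb k (p a n)) (kernel_comb k (p a n)) - ip (g a) (kernel_comb k (p a n)))"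
        using ip_sym[OF r m, of n n] ip_diff[OF m g[OF a] m, of n n] by (simp only:)
      also have "ip (g a) (?r n) = cnj (ip (kernel_comb k (p a n)) (g a) - ip (g a) (g a))"
        using ip_sym[OF r g[OF a], of n] ip_diff[OF m g[OF a] g[OF a], of n] by (simp only:)
      also have "ip (kernel_comb k (p a n)) (g a) = cnj (ip (g a) (kernel_comb k (p a n)))" by (rule ip_sym[OF g[OF a] m])
      finally show ?thesis
        by (simp add: ip_norm_sq r g[OF a] ip_kernel_comb[OF p[OF a] m] ip_kernel_comb[OF p[OF a] g[OF a]])
    qed
    moreover have "(\<lambda>n. (ip_norm ip (?r n))\<^sup>2 + 2 * Re (pairing (p a n) (g a)) - (ip_norm ip (g a))\<^sup>2)
        \<longlonglongrightarrow> 0\<^sup>2 + 2 * Re (of_real ((ip_norm ip (g a))\<^sup>2)) - (ip_norm ip (g a))\<^sup>2"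
      by (intro tendsto_intros lim[OF a] pairing_lim[OF a])
    ultimately show ?thesis by simp
  qed
  have "(\<lambda>n. (cmod (\<Sum>a\<in>I. pairing (p a n) (g a)))\<^sup>2) \<longlonglongrightarrow> (cmod (\<Sum>a\<in>I. of_real ((ip_norm ip (g a))\<^sup>2)))\<^sup>2"
    by (intro tendsto_intros pairing_lim)
  moreover have "(\<Sum>a\<in>I. of_real ((ip_norm ip (g a))\<^sup>2)) = (of_real N2 :: complex)"
    by (simp add: N2_def)
  ultimately have "(\<lambda>n. (cmod (\<Sum>a\<in>I. pairing (p a n) (g a)))\<^sup>2) \<longlonglongrightarrow> N2\<^sup>2" by (simp only: norm_of_real power2_abs)
  moreover have "(\<lambda>n. A * (\<Sum>a\<in>I. Re (hform k (p a n) (p a n)))) \<longlonglongrightarrow> A * N2"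
    unfolding N2_def by (intro tendsto_intros hform_lim)
  ultimately have "N2\<^sup>2 \<le> A * N2"
    by (rule LIMSEQ_le) (use bd p in auto)
  then have "N2 \<le> A" using N2 A by (cases "N2 = 0") (auto simp: power2_eq_square)
  then show "(\<Sum>a\<in>I. (ip_norm ip (g a))\<^sup>2) \<le> A" by (simp add: N2_def)
qed

end

text \<open>
The adjoint of multiplication by \<open>M\<close> would send the section of \<open>l\<close> at \<open>x\<close>, tensored with a vector, to
the section of \<open>k\<close> at \<open>x\<close>, tensored with the image of that vector under the adjoint matrix. On
coefficients this is the map from \<open>d\<close> to \<open>e\<close> in the proof, and positivity of the kernel says that it is
a contraction. By duality \<open>M f\<close> is a bounded functional, with bound the norm of \<open>f\<close>.
\<close>

lemma pick_psd_imp_multiplier: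
  fixes f :: "nat \<Rightarrow> 'x \<Rightarrow> complex" and M :: "'x \<Rightarrow> nat \<Rightarrow> nat \<Rightarrow> complex"
  assumes k: "reproducing_space k H ip" and l: "reproducing_space l H' ip'"
    and psd: "psd_on (UNIV \<times> {..<N}) (\<lambda>i j. pick_kernel N k l ((fst i, M (fst i)), snd i) ((fst j, M (fst j)), snd j))"
    and f: "\<And>b. b < N \<Longrightarrow> f b \<in> H"
  defines "g \<equiv> \<lambda>a x. \<Sum>b<N. M x a b * f b x"
  shows "\<And>a. a < N \<Longrightarrow> g a \<in> H'"
    and "(\<Sum>a<N. (ip_norm ip' (g a))\<^sup>2) \<le> (\<Sum>b<N. (ip_norm ip (f b))\<^sup>2)"
proof -
  interpret K: reproducing_space k H ip by (rule k)
  interpret L: reproducing_space l H' ip' by (rule l)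
  let ?A = "\<Sum>b<N. (ip_norm ip (f b))\<^sup>2"
  have bd: "(cmod (\<Sum>a<N. pairing (d a) (g a)))\<^sup>2 \<le> ?A * (\<Sum>a<N. Re (hform l (d a) (d a)))"
    if d: "\<And>a. a \<in> {..<N} \<Longrightarrow> d a \<in> fin_supp UNIV" for d
  proof -
    define F where "F = (\<Union>a<N. {x. d a x \<noteq> 0})"
    have F: "finite F" using d by (auto simp: F_def fin_supp_def)
    have dF: "{x. d a x \<noteq> 0} \<subseteq> F" if "a < N" for a using that by (auto simp: F_def)
    define e where "e b x = (\<Sum>a<N. cnj (M x a b) * d a x)" for b x
    have eF: "{x. e b x \<noteq> 0} \<subseteq> F" for b
    proof
      fix x assume "x \<in> {x. e b x \<noteq> 0}"
      then obtain a where "a < N" "d a x \<noteq> 0"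
        unfolding e_def by (auto elim: sum.not_neutral_contains_not_neutral)
      then show "x \<in> F" by (auto simp: F_def)
    qed
    have e: "e b \<in> fin_supp UNIV" for b using finite_subset[OF eF F] by (simp add: fin_supp_def)
    have "(\<Sum>a<N. pairing (d a) (g a)) = (\<Sum>a<N. \<Sum>x\<in>F. \<Sum>b<N. cnj (d a x) * M x a b * f b x)"
      by (intro sum.cong refl) (simp add: pairing_eq_sum[OF F dF] g_def sum_distrib_left mult_ac)
    also have "\<dots> = (\<Sum>x\<in>F. \<Sum>a<N. \<Sum>b<N. cnj (d a x) * M x a b * f b x)" by (rule sum.swap)
    also have "\<dots> = (\<Sum>x\<in>F. \<Sum>b<N. \<Sum>a<N. cnj (d a x) * M x a b * f b x)"
      by (intro sum.cong refl sum.swap)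
    also have "\<dots> = (\<Sum>b<N. \<Sum>x\<in>F. \<Sum>a<N. cnj (d a x) * M x a b * f b x)" by (rule sum.swap)
    also have "\<dots> = (\<Sum>b<N. pairing (e b) (f b))"
      by (intro sum.cong refl) (simp add: pairing_eq_sum[OF F eF] e_def sum_distrib_left sum_distrib_right mult_ac)
    also have "\<dots> = (\<Sum>b<N. ip (f b) (kernel_comb k (e b)))"
      using K.ip_kernel_comb[OF e f] by simp
    finally have "cmod (\<Sum>a<N. pairing (d a) (g a)) = cmod (\<Sum>b<N. ip (f b) (kernel_comb k (e b)))" by simp
    also have "\<dots> \<le> (\<Sum>b<N. ip_norm ip (f b) * ip_norm ip (kernel_comb k (e b)))"
      by (rule sum_norm_le) (use K.cauchy_schwarz[OF f K.kernel_comb_mem[OF e]] in auto)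
    finally have "(cmod (\<Sum>a<N. pairing (d a) (g a)))\<^sup>2 \<le> (\<Sum>b<N. ip_norm ip (f b) * ip_norm ip (kernel_comb k (e b)))\<^sup>2"
      by (rule power_mono) simp
    also have "\<dots> \<le> ?A * (\<Sum>b<N. (ip_norm ip (kernel_comb k (e b)))\<^sup>2)" by (rule Cauchy_Schwarz_ineq_sum)
    also have "(\<Sum>b<N. (ip_norm ip (kernel_comb k (e b)))\<^sup>2) = (\<Sum>b<N. Re (hform k (e b) (e b)))"
      using K.ip_norm_kernel_comb[OF e] Re_hform_nonneg[OF K.kernel_psd e] by simp
    also have "?A * \<dots> \<le> ?A * (\<Sum>a<N. Re (hform l (d a) (d a)))"
    proof (rule mult_left_mono)
      let ?S = "F \<times> {..<N}"
      define c where "c i = d (snd i) (fst i)" for i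
      have T1: "(\<Sum>a<N. hform l (d a) (d a)) = (\<Sum>i\<in>?S. \<Sum>j\<in>?S. cnj (c i) *
          (l (fst i) (fst j) * (if snd i = snd j then 1 else 0)) * c j)"
      proof -
        have "(\<Sum>i\<in>?S. \<Sum>j\<in>?S. cnj (c i) * (l (fst i) (fst j) * (if snd i = snd j then 1 else 0)) * c j)
          = (\<Sum>x\<in>F. \<Sum>a<N. \<Sum>y\<in>F. \<Sum>b<N. if b = a then cnj (d a x) * l x y * d a y else 0)"
          unfolding sum.cartesian_product'
          by (intro sum.cong refl) (auto simp: c_def mult_ac)
        also have "\<dots> = (\<Sum>x\<in>F. \<Sum>a<N. \<Sum>y\<in>F. cnj (d a x) * l x y * d a y)"
          by (intro sum.cong refl) simp
        also have "\<dots> = (\<Sum>a<N. \<Sum>x\<in>F. \<Sum>y\<in>F. cnj (d a x) * l x y * d a y)" by (rule sum.swap)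
        also have "\<dots> = (\<Sum>a<N. hform l (d a) (d a))"
          by (intro sum.cong refl hform_eq_sum[symmetric] F dF) auto
        finally show ?thesis ..
      qed
      have T2: "(\<Sum>b<N. hform k (e b) (e b)) = (\<Sum>i\<in>?S. \<Sum>j\<in>?S. cnj (c i) *
          (k (fst i) (fst j) * (\<Sum>b<N. M (fst i) (snd i) b * cnj (M (fst j) (snd j) b))) * c j)"
      proof -
        let ?t = "\<lambda>x a y a' b. cnj (d a x) * (k x y * (M x a b * cnj (M y a' b))) * d a' y"
        have "(\<Sum>b<N. hform k (e b) (e b)) = (\<Sum>b<N. \<Sum>x\<in>F. \<Sum>y\<in>F. \<Sum>a<N. \<Sum>a'<N. ?t x a y a' b)"
        proof (intro sum.cong refl)
          fix b
          have "hform k (e b) (e b) = (\<Sum>x\<in>F. \<Sum>y\<in>F. cnj (e b x) * k x y * e b y)"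
            by (rule hform_eq_sum[OF F eF eF])
          also have "\<dots> = (\<Sum>x\<in>F. \<Sum>y\<in>F. \<Sum>a<N. \<Sum>a'<N. ?t x a y a' b)"
            by (intro sum.cong refl)
               (simp add: e_def sum_distrib_left sum_distrib_right mult_ac)
          finally show "hform k (e b) (e b) = \<dots>" .
        qed
        also have "\<dots> = (\<Sum>b<N. \<Sum>x\<in>F. \<Sum>a<N. \<Sum>y\<in>F. \<Sum>a'<N. ?t x a y a' b)"
          by (intro sum.cong refl sum.swap)
        also have "\<dots> = (\<Sum>b<N. \<Sum>i\<in>?S. \<Sum>j\<in>?S. ?t (fst i) (snd i) (fst j) (snd j) b)"
          by (simp add: sum.cartesian_product')
        also have "\<dots> = (\<Sum>i\<in>?S. \<Sum>b<N. \<Sum>j\<in>?S. ?t (fst i) (snd i) (fst j) (snd j) b)" by (rule sum.swap)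
        also have "\<dots> = (\<Sum>i\<in>?S. \<Sum>j\<in>?S. \<Sum>b<N. ?t (fst i) (snd i) (fst j) (snd j) b)"
          by (intro sum.cong refl sum.swap)
        finally show ?thesis by (simp add: c_def sum_distrib_left sum_distrib_right)
      qed
      have "0 \<le> (\<Sum>i\<in>?S. \<Sum>j\<in>?S. cnj (c i) *
          pick_kernel N k l ((fst i, M (fst i)), snd i) ((fst j, M (fst j)), snd j) * c j)"
        by (rule psd_onD[OF psd]) (use F in auto)
      also have "\<dots> = (\<Sum>a<N. hform l (d a) (d a)) - (\<Sum>b<N. hform k (e b) (e b))"
        unfolding T1 T2 sum_subtractf[symmetric] by (simp add: pick_kernel_def algebra_simps)
      finally show "(\<Sum>b<N. Re (hform k (e b) (e b))) \<le> (\<Sum>a<N. Re (hform l (d a) (d a)))"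
        by (simp add: complex_nonneg_iff)
    qed (simp add: sum_nonneg)
    finally show ?thesis .
  qed
  have A: "0 \<le> ?A" by (simp add: sum_nonneg)
  show "\<And>a. a < N \<Longrightarrow> g a \<in> H'"
    using L.bounded_functional_tuple(1)[OF A finite_lessThan bd] by simp
  show "(\<Sum>a<N. (ip_norm ip' (g a))\<^sup>2) \<le> ?A"
    by (rule L.bounded_functional_tuple(2)[OF A finite_lessThan bd])
qed

section \<open>Complete Pick pairs\<close>

lemma is_kernel_imp_psd_on:
  fixes k :: "'x \<Rightarrow> 'x \<Rightarrow> complex"
  assumes "is_kernel k"
  shows "psd_on UNIV k"
  unfolding psd_on_def
proof (intro allI impI)
  fix F :: "'x set" and c :: "'x \<Rightarrow> complex" assume "finite F"
  then obtain h :: "nat \<Rightarrow> 'x" where h: "bij_betw h {..<card F} F"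
    using ex_bij_betw_nat_finite by (metis atLeast0LessThan)
  have inner: "(\<Sum>j<card F. cnj (c (h i)) * k (h i) (h j) * c (h j))
      = (\<Sum>j\<in>F. cnj (c (h i)) * k (h i) j * c j)" for i
    by (rule sum.reindex_bij_betw[OF h])
  have "0 \<le> (\<Sum>i<card F. \<Sum>j<card F. cnj (c (h i)) * k (h i) (h j) * c (h j))"
    using assms unfolding is_kernel_def by (elim allE[of _ "card F"] allE[of _ h] allE[of _ "\<lambda>i. c (h i)"])
  also have "\<dots> = (\<Sum>i\<in>F. \<Sum>j\<in>F. cnj (c i) * k i j * c j)"
    unfolding inner by (rule sum.reindex_bij_betw[OF h])
  finally show "0 \<le> (\<Sum>i\<in>F. \<Sum>j\<in>F. cnj (c i) * k i j * c j)" .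
qed

lemma mat_adjoint_index:
  assumes "A \<in> carrier_mat n m" "i < m" "j < n"
  shows "mat_adjoint A $$ (i, j) = conjugate (A $$ (j, i))"
  using assms by (simp add: mat_adjoint_def mat_of_rows_index)

text \<open>
The index \<open>i\<close> is replaced by the pair of its point and its matrix. Indices with equal pairs
are merged by choosing one preimage of each.
\<close>

lemma block_psd_imp_pick_psd:
  assumes W: "\<And>i. i < n \<Longrightarrow> W i \<in> carrier_mat N N"
    and psd: "block_psd n N (\<lambda>i j. l (z i) (z j) \<cdot>\<^sub>m 1\<^sub>m N - k (z i) (z j) \<cdot>\<^sub>m (W i * mat_adjoint (W j)))"
  shows "psd_on ((\<lambda>i. (z i, \<lambda>a c. W i $$ (a, c))) ` {..<n} \<times> {..<N}) (pick_kernel N k l)"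
proof -
  let ?h = "\<lambda>i. (z i, \<lambda>a c. W i $$ (a, c))" and ?S = "{..<n} \<times> {..<N}"
  let ?K = "\<lambda>i j. pick_kernel N k l (?h (fst i), snd i) (?h (fst j), snd j)"
  have psdK: "psd_on ?S ?K"
  proof (rule psd_onI_hform)
    fix c assume c: "c \<in> fin_supp ?S"
    then have S: "finite ?S" "{i. c i \<noteq> 0} \<subseteq> ?S" by (auto simp: fin_supp_def)
    define u where "u i = vec N (\<lambda>a. c (i, a))" for i
    let ?B = "\<lambda>i j. l (z i) (z j) \<cdot>\<^sub>m 1\<^sub>m N - k (z i) (z j) \<cdot>\<^sub>m (W i * mat_adjoint (W j))"
    have entry: "?B i j $$ (a, b) = pick_kernel N k l (?h i, a) (?h j, b)"
      if "i < n" "j < n" "a < N" "b < N" for i j a b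
    proof -
      have Wi: "W i \<in> carrier_mat N N" and Wj: "W j \<in> carrier_mat N N" using W that by auto
      have adj: "mat_adjoint (W j) \<in> carrier_mat N N" using Wj by (auto simp: mat_adjoint_def)
      have "(W i * mat_adjoint (W j)) $$ (a, b) = (\<Sum>c<N. W i $$ (a, c) * cnj (W j $$ (b, c)))"
        using Wi adj that
        by (simp add: scalar_prod_def atLeast0LessThan mat_adjoint_index[OF Wj])
      then show ?thesis using Wi adj that by (simp add: pick_kernel_def)
    qed
    have block: "(?B i j *\<^sub>v u j) \<bullet>c u i
        = (\<Sum>a<N. \<Sum>b<N. cnj (c (i, a)) * pick_kernel N k l (?h i, a) (?h j, b) * c (j, b))"
      if "i < n" "j < n" for i j
    proof -
      have Wi: "W i \<in> carrier_mat N N" and Wj: "W j \<in> carrier_mat N N" using W that by auto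
      have adj: "mat_adjoint (W j) \<in> carrier_mat N N" using Wj by (auto simp: mat_adjoint_def)
      have B: "?B i j \<in> carrier_mat N N" using Wi adj by auto
      have "(?B i j *\<^sub>v u j) \<bullet>c u i = (\<Sum>a<N. (?B i j *\<^sub>v u j) $ a * cnj (c (i, a)))"
        by (simp add: scalar_prod_def atLeast0LessThan u_def)
      also have "\<dots> = (\<Sum>a<N. (\<Sum>b<N. ?B i j $$ (a, b) * c (j, b)) * cnj (c (i, a)))"
      proof (intro sum.cong refl)
        fix a assume "a \<in> {..<N}"
        then have "(?B i j *\<^sub>v u j) $ a = row (?B i j) a \<bullet> u j" using B by (intro index_mult_mat_vec) auto
        also have "\<dots> = (\<Sum>b<N. ?B i j $$ (a, b) * c (j, b))"
          unfolding scalar_prod_def u_def atLeast0LessThan dim_vec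
          by (intro sum.cong refl)
             (use B carrier_matD[OF B] \<open>a \<in> {..<N}\<close> in \<open>simp del: index_minus_mat\<close>)
        finally show "(?B i j *\<^sub>v u j) $ a * cnj (c (i, a)) = (\<Sum>b<N. ?B i j $$ (a, b) * c (j, b)) * cnj (c (i, a))"
          by simp
      qed
      also have "\<dots> = (\<Sum>a<N. \<Sum>b<N. cnj (c (i, a)) * pick_kernel N k l (?h i, a) (?h j, b) * c (j, b))"
        unfolding sum_distrib_right
        by (intro sum.cong refl) (simp add: entry[OF that] mult_ac del: index_minus_mat)
      finally show ?thesis .
    qed
    have "0 \<le> (\<Sum>i<n. \<Sum>j<n. (?B i j *\<^sub>v u j) \<bullet>c u i)"
      using psd unfolding block_psd_def by (elim allE[of _ u]) (simp add: u_def)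
    also have "\<dots> = (\<Sum>i<n. \<Sum>j<n. \<Sum>a<N. \<Sum>b<N. cnj (c (i, a)) * pick_kernel N k l (?h i, a) (?h j, b) * c (j, b))"
      by (intro sum.cong refl block) auto
    also have "\<dots> = (\<Sum>i<n. \<Sum>a<N. \<Sum>j<n. \<Sum>b<N. cnj (c (i, a)) * pick_kernel N k l (?h i, a) (?h j, b) * c (j, b))"
      by (intro sum.cong refl sum.swap)
    also have "\<dots> = hform ?K c c"
      by (subst hform_eq_sum[OF S S(2)]) (simp add: sum.cartesian_product')
    finally show "0 \<le> hform ?K c c" .
  qed
  have inv: "inv_into {..<n} ?h q \<in> {..<n}" "?h (inv_into {..<n} ?h q) = q"
    if "q \<in> ?h ` {..<n}" for q
    by (rule inv_into_into[OF that], rule f_inv_into_f[OF that])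
  define r where "r p = (inv_into {..<n} ?h (fst p), snd p :: nat)" for p
  have "r ` (?h ` {..<n} \<times> {..<N}) \<subseteq> ?S"
  proof
    fix q assume "q \<in> r ` (?h ` {..<n} \<times> {..<N})"
    then obtain p where "q = r p" "fst p \<in> ?h ` {..<n}" "snd p \<in> {..<N}" by auto
    then show "q \<in> ?S" using inv(1) by (simp only: r_def mem_Sigma_iff)
  qed
  from psd_on_pullback[OF psdK this]
  have "psd_on (?h ` {..<n} \<times> {..<N}) (\<lambda>p q. ?K (r p) (r q))" .
  then show ?thesis
  proof (rule psd_on_cong)
    fix p q assume "p \<in> ?h ` {..<n} \<times> {..<N}" "q \<in> ?h ` {..<n} \<times> {..<N}"
    then have "fst p \<in> ?h ` {..<n}" "fst q \<in> ?h ` {..<n}" by auto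
    then show "pick_kernel N k l p q
        = ?K (r p) (r q)"
      by (simp only: r_def fst_conv snd_conv inv prod.collapse)
  qed
qed

theorem theorem4p5:
  fixes k l :: "'x \<Rightarrow> 'x \<Rightarrow> complex"
  assumes "is_kernel k" and "is_kernel l"
    and "\<And>x. k x x \<noteq> 0" and "\<And>x. l x x \<noteq> 0"
    and "\<exists>p. shimorin_certificate k l p"
  shows "complete_pick_pair k l"
  unfolding complete_pick_pair_def
proof (intro allI impI)
  fix H ip H' ip' and n N :: nat and z W
  assume H: "rkhs k H ip" and H': "rkhs l H' ip'"
    and W: "\<forall>i<n. W i \<in> carrier_mat N N"
    and psd: "block_psd n N (\<lambda>i j. l (z i) (z j) \<cdot>\<^sub>m 1\<^sub>m N - k (z i) (z j) \<cdot>\<^sub>m (W i * mat_adjoint (W j)))"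
  note k = is_kernel_imp_psd_on[OF assms(1)] and l = is_kernel_imp_psd_on[OF assms(2)]
  obtain p where p: "shimorin_certificate k l p" using assms(5) by blast
  let ?G0 = "(\<lambda>i. (z i, \<lambda>a c. W i $$ (a, c))) ` {..<n}"
  have step: "\<exists>M. psd_on (insert (x, M) G \<times> {..<N}) (pick_kernel N k l)"
    if "psd_on (G \<times> {..<N}) (pick_kernel N k l)" "x \<notin> fst ` G" for G x
    using p that
    by (intro pick_one_point_extension[OF k l _ assms(3,4), of "p x"] is_kernel_imp_psd_on)
       (auto simp: shimorin_certificate_def kernel_le_def)
  have "psd_on (?G0 \<times> {..<N}) (pick_kernel N k l)"
    using W psd by (intro block_psd_imp_pick_psd) auto
  from pick_total_extension[OF step this] obtain G where
    G: "?G0 \<subseteq> G" "psd_on (G \<times> {..<N}) (pick_kernel N k l)" "fst ` G = UNIV" by blast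
  have "\<exists>M. (x, M) \<in> G" for x using G(3) by (metis UNIV_I imageE prod.collapse)
  then obtain M where M: "\<And>x. (x, M x) \<in> G" by metis
  define \<Phi> where "\<Phi> x = mat N N (\<lambda>(a, c). M x a c)" for x
  have \<Phi>psd: "psd_on (UNIV \<times> {..<N})
      (\<lambda>i j. pick_kernel N k l ((fst i, M (fst i)), snd i) ((fst j, M (fst j)), snd j))"
    by (rule psd_on_pullback[OF G(2)]) (use M in auto)
  have mult: "(\<forall>a<N. (\<lambda>x. (\<Phi> x *\<^sub>v f x) $ a) \<in> H') \<and> tensor_norm N ip' (\<lambda>x. \<Phi> x *\<^sub>v f x) \<le> tensor_norm N ip f"
    if f: "f \<in> tensor_space N H" for f
  proof -
    have fx: "f x \<in> carrier_vec N" for x using f by (simp add: tensor_space_def)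
    have fb: "(\<lambda>x. f x $ b) \<in> H" if "b < N" for b using f that by (simp add: tensor_space_def)
    have comp: "(\<lambda>x. (\<Phi> x *\<^sub>v f x) $ a) = (\<lambda>x. \<Sum>b<N. M x a b * f x $ b)" if "a < N" for a
      using that fx by (auto simp: \<Phi>_def scalar_prod_def atLeast0LessThan carrier_vecD[OF fx])
    note mm = pick_psd_imp_multiplier[OF reproducing_space.intro[OF H] reproducing_space.intro[OF H'] \<Phi>psd,
        of "\<lambda>b x. f x $ b", OF fb]
    show ?thesis using mm by (auto simp: comp tensor_norm_def)
  qed
  show "\<exists>\<Phi>\<in>Mult N H H'. mult_norm N H ip ip' \<Phi> \<le> 1 \<and> (\<forall>i<n. \<Phi> (z i) = W i)"
  proof (intro bexI conjI allI impI)
    show "\<Phi> \<in> Mult N H H'"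
      using mult by (auto simp: Mult_def tensor_space_def \<Phi>_def intro!: mult_mat_vec_carrier)
    show "mult_norm N H ip ip' \<Phi> \<le> 1"
      unfolding mult_norm_def by (rule SUP_least) (use mult order_trans in force)
    fix i assume i: "i < n"
    show "\<Phi> (z i) = W i"
    proof (rule eq_matI)
      fix a c assume "a < dim_row (W i)" "c < dim_col (W i)"
      then have ac: "a < N" "c < N" using W i by auto
      have "(z i, \<lambda>a c. W i $$ (a, c)) \<in> G" using G(1) i by auto
      then have "M (z i) a c = W i $$ (a, c)"
        using pick_values_unique[OF G(2) M _ psd_on_diag[OF k] assms(3) ac] by simp
      then show "\<Phi> (z i) $$ (a, c) = W i $$ (a, c)" using ac by (simp add: \<Phi>_def)
    qed (use W i in \<open>auto simp: \<Phi>_def\<close>)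
  qed
qed

end
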